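(* Let $q$ be a prime power and let $(\Lambda,\lesssim)$ be an infinite $\mathbb{Z}$-like preordered set. Then $\mathrm{QZ}\bigl(\mathrm{AU}_{\Lambda}(\mathbb{F}_q)/\mathrm{Z}_{\Lambda}(\mathbb{F}_q)\bigr)=\{1\}$.
   Context: For a topological group $G$, the quasi-centre $\mathrm{QZ}(G)$ is the set of elements of $G$ whose centraliser in $G$ is open. Let $(\Lambda,\lesssim)$ be a preordered set ($\lesssim$ reflexive and transitive). Write $i\sim j$ if $i\lesssim j$ and $j\lesssim i$; $i\lnsim j$ if $i\lesssim j$ and $i\not\sim j$; $[i,j]=\{k\in\Lambda : i\lesssim k\lesssim j\}$. A subset $\Lambda'\subseteq\Lambda$ is convex if $[i,j]\subseteq\Lambda'$ whenever $i,j\in\Lambda'$; it is strongly convex if for every $i\in\Lambda\setminus\Lambda'$ either $i\lnsim j$ for all $j\in\Lambda'$, or $j\lnsim i$ for all $j\in\Lambda'$. $(\Lambda,\lesssim)$ is $\mathbb{Z}$-like if every finite subset of $\Lambda$ is contained in a finite strongly convex subset. A $(\Lambda\times\Lambda)$-matrix over a commutative unital ring $R$ is a tuple $(a_{ij})_{i,j\in\Lambda}$ of elements of $R$; $\mathrm{M}_\Lambda(R)$ is the set of these. The product of $(a_{ij})$ and $(b_{ij})$ is $(\sum_{k}a_{ik}b_{kj})_{i,j}$, defined only when each of these sums has finitely many nonzero terms. The matrix $(a_{ij})$ is nonsingular if there is a finite convex $\Lambda'\subseteq\Lambda$ such that $(a_{ij})_{i,j\in\Lambda''}$ is invertible over $R$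 for every finite convex $\Lambda''\supseteq\Lambda'$; upper triangular if $a_{ij}=0$ whenever $i\not\lesssim j$; almost upper triangular if $a_{ij}=0$ for all but finitely many pairs $(i,j)$ with $i\not\lesssim j$; scalar if $a_{ij}=0$ for $i\neq j$ and $a_{ii}$ is constant. $\mathrm{U}_\Lambda(R)$, $\mathrm{AU}_\Lambda(R)$ and $\mathrm{Z}_\Lambda(R)$ are the groups (under matrix multiplication) of nonsingular upper triangular, nonsingular almost upper triangular, and nonsingular scalar matrices, respectively. Topology ($R$ discrete; finite fields are discrete): for any $\mathbb{Z}$-like preorder, $\mathrm{U}_\Lambda(R)$ carries the subspace topology from the product topology on $\mathrm{M}_\Lambda(R)=R^{\Lambda\times\Lambda}$. For a finite convex $\Lambda'\subseteq\Lambda$, $\Lambda+\Lambda'$ denotes the set $\Lambda$ with the smallest preorder containing $\lesssim$ and making all elements of $\Lambda'$ equivalent (it is again $\mathbb{Z}$-like). $\mathrm{AU}_\Lambda(R)$ is the union of its subgroups $\mathrm{U}_{\Lambda+\Lambda'}(R)$ and carries the unique group topology for which the inclusion of $\mathrm{U}_{\Lambda+\Lambda'}(R)$ into $\mathrm{AU}_\Lambda(R)$ is continuous and open for every finite convex $\Lambda'\subseteq\Lambda$. *)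

theory Defs
  imports
    "HOL-Analysis.Analysis"
    "HOL-Algebra.Coset"
    "HOL-Library.Groups_Big_Fun"
    "HOL-Number_Theory.Prime_Powers"
begin

section \<open>Topological groups, quotients and the quasi-centre\<close>

definition group_topology :: "('a, 'b) monoid_scheme \<Rightarrow> 'a topology \<Rightarrow> bool" where
  "group_topology G T \<longleftrightarrow>
     group G \<and> topspace T = carrier G \<and>
     continuous_map (prod_topology T T) T (\<lambda>(x, y). x \<otimes>\<^bsub>G\<^esub> y) \<and>
     continuous_map T T (\<lambda>x. inv\<^bsub>G\<^esub> x)"

definition quotient_group_topology ::
    "('a, 'b) monoid_scheme \<Rightarrow> 'a set \<Rightarrow> 'a topology \<Rightarrow> 'a set topology" where
  "quotient_group_topology G N T =
     topology (\<lambda>W. W \<subseteq> carrier (G Mod N) \<and> openin T {x \<in> carrier G. N #>\<^bsub>G\<^esub> x \<in> W})"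

lemma openin_quotient_group_topology:
  "openin (quotient_group_topology G N T) W \<longleftrightarrow>
     W \<subseteq> carrier (G Mod N) \<and> openin T {x \<in> carrier G. N #>\<^bsub>G\<^esub> x \<in> W}"
proof -
  let ?P = "\<lambda>W. W \<subseteq> carrier (G Mod N) \<and> openin T {x \<in> carrier G. N #>\<^bsub>G\<^esub> x \<in> W}"
  have int: "?P (S \<inter> S')" if "?P S" "?P S'" for S S'
  proof -
    have "{x \<in> carrier G. N #>\<^bsub>G\<^esub> x \<in> S \<inter> S'} =
          {x \<in> carrier G. N #>\<^bsub>G\<^esub> x \<in> S} \<inter> {x \<in> carrier G. N #>\<^bsub>G\<^esub> x \<in> S'}"
      by blast
    with that show ?thesis
      by auto
  qed
  have union: "?P (\<Union>K)" if "\<forall>S\<in>K. ?P S" for K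
  proof -
    have "{x \<in> carrier G. N #>\<^bsub>G\<^esub> x \<in> \<Union>K} = (\<Union>S\<in>K. {x \<in> carrier G. N #>\<^bsub>G\<^esub> x \<in> S})"
      by blast
    with that show ?thesis
      by auto
  qed
  have "istopology ?P"
    unfolding istopology_def using int union by presburger
  then show ?thesis
    by (simp add: quotient_group_topology_def topology_inverse')
qed

lemma quotient_map_quotient_group_topology:
  assumes "topspace T = carrier G"
  shows "quotient_map T (quotient_group_topology G N T) (\<lambda>x. N #>\<^bsub>G\<^esub> x)"
proof -
  have img: "(\<lambda>x. N #>\<^bsub>G\<^esub> x) ` carrier G = carrier (G Mod N)"
    by (auto simp: FactGroup_def RCOSETS_def)
  have "openin (quotient_group_topology G N T) (carrier (G Mod N))"
  proof -
    have "{x \<in> carrier G. N #>\<^bsub>G\<^esub> x \<in> carrier (G Mod N)} = topspace T"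
      using img assms by blast
    then show ?thesis
      by (simp add: openin_quotient_group_topology)
  qed
  then have top: "topspace (quotient_group_topology G N T) = carrier (G Mod N)"
    by (meson openin_quotient_group_topology openin_subset openin_topspace subset_antisym)
  show ?thesis
    unfolding quotient_map_def top assms
    using img by (auto simp: openin_quotient_group_topology)
qed

definition centraliser :: "('a, 'b) monoid_scheme \<Rightarrow> 'a \<Rightarrow> 'a set" where
  "centraliser G x = {y \<in> carrier G. x \<otimes>\<^bsub>G\<^esub> y = y \<otimes>\<^bsub>G\<^esub> x}"

definition quasi_centre :: "('a, 'b) monoid_scheme \<Rightarrow> 'a topology \<Rightarrow> 'a set" where
  "quasi_centre G T = {x \<in> carrier G. openin T (centraliser G x)}"


section \<open>Preordered sets\<close>

text \<open>
  The underlying set of a preordered set is a whole type; the preorder is an explicit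
  argument because several preorders on the same set are considered at once.
\<close>

definition is_preorder :: "('i \<Rightarrow> 'i \<Rightarrow> bool) \<Rightarrow> bool" where
  "is_preorder leq \<longleftrightarrow> reflp leq \<and> transp leq"

definition pre_equiv :: "('i \<Rightarrow> 'i \<Rightarrow> bool) \<Rightarrow> 'i \<Rightarrow> 'i \<Rightarrow> bool" where
  "pre_equiv leq i j \<longleftrightarrow> leq i j \<and> leq j i"

definition pre_less :: "('i \<Rightarrow> 'i \<Rightarrow> bool) \<Rightarrow> 'i \<Rightarrow> 'i \<Rightarrow> bool" where
  "pre_less leq i j \<longleftrightarrow> leq i j \<and> \<not> pre_equiv leq i j"

definition pre_interval :: "('i \<Rightarrow> 'i \<Rightarrow> bool) \<Rightarrow> 'i \<Rightarrow> 'i \<Rightarrow> 'i set" where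
  "pre_interval leq i j = {k. leq i k \<and> leq k j}"

definition pre_convex :: "('i \<Rightarrow> 'i \<Rightarrow> bool) \<Rightarrow> 'i set \<Rightarrow> bool" where
  "pre_convex leq S \<longleftrightarrow> (\<forall>i\<in>S. \<forall>j\<in>S. pre_interval leq i j \<subseteq> S)"

definition strongly_convex :: "('i \<Rightarrow> 'i \<Rightarrow> bool) \<Rightarrow> 'i set \<Rightarrow> bool" where
  "strongly_convex leq S \<longleftrightarrow>
     (\<forall>i\<in>UNIV - S. (\<forall>j\<in>S. pre_less leq i j) \<or> (\<forall>j\<in>S. pre_less leq j i))"

definition Z_like :: "('i \<Rightarrow> 'i \<Rightarrow> bool) \<Rightarrow> bool" where
  "Z_like leq \<longleftrightarrow> (\<forall>F. finite F \<longrightarrow> (\<exists>S. F \<subseteq> S \<and> finite S \<and> strongly_convex leq S))"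

text \<open>
  The preorder of \<open>\<Lambda> + S\<close>: the smallest preorder containing \<open>leq\<close> and \<open>S \<times> S\<close>.
\<close>

definition pre_collapse :: "('i \<Rightarrow> 'i \<Rightarrow> bool) \<Rightarrow> 'i set \<Rightarrow> 'i \<Rightarrow> 'i \<Rightarrow> bool" where
  "pre_collapse leq S = (\<lambda>i j. leq i j \<or> (i \<in> S \<and> j \<in> S))\<^sup>*\<^sup>*"


section \<open>Matrices over a preordered set\<close>

type_synonym ('i, 'r) mat = "'i \<times> 'i \<Rightarrow> 'r"

text \<open>
  Entries given by a sum with infinitely many nonzero terms get the junk value \<open>0\<close>;
  such products do not occur inside the groups below.
\<close>

definition mat_mult :: "('i, 'r::comm_ring_1) mat \<Rightarrow> ('i, 'r) mat \<Rightarrow> ('i, 'r) mat" where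
  "mat_mult a b = (\<lambda>(i, j). Sum_any (\<lambda>k. a (i, k) * b (k, j)))"

definition mat_one :: "('i, 'r::comm_ring_1) mat" where
  "mat_one = (\<lambda>(i, j). if i = j then 1 else 0)"

definition invertible_block :: "'i set \<Rightarrow> ('i, 'r::comm_ring_1) mat \<Rightarrow> bool" where
  "invertible_block S a \<longleftrightarrow>
     (\<exists>b :: ('i, 'r) mat. \<forall>i\<in>S. \<forall>j\<in>S.
        (\<Sum>k\<in>S. a (i, k) * b (k, j)) = mat_one (i, j) \<and>
        (\<Sum>k\<in>S. b (i, k) * a (k, j)) = mat_one (i, j))"

definition nonsingular :: "('i \<Rightarrow> 'i \<Rightarrow> bool) \<Rightarrow> ('i, 'r::comm_ring_1) mat \<Rightarrow> bool" where
  "nonsingular leq a \<longleftrightarrow>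
     (\<exists>S. finite S \<and> pre_convex leq S \<and>
        (\<forall>S'. finite S' \<and> pre_convex leq S' \<and> S \<subseteq> S' \<longrightarrow> invertible_block S' a))"

definition upper_triangular :: "('i \<Rightarrow> 'i \<Rightarrow> bool) \<Rightarrow> ('i, 'r::comm_ring_1) mat \<Rightarrow> bool" where
  "upper_triangular leq a \<longleftrightarrow> (\<forall>i j. \<not> leq i j \<longrightarrow> a (i, j) = 0)"

definition almost_upper_triangular ::
    "('i \<Rightarrow> 'i \<Rightarrow> bool) \<Rightarrow> ('i, 'r::comm_ring_1) mat \<Rightarrow> bool" where
  "almost_upper_triangular leq a \<longleftrightarrow> finite {(i, j). \<not> leq i j \<and> a (i, j) \<noteq> 0}"

definition scalar_mat :: "('i, 'r::comm_ring_1) mat \<Rightarrow> bool" where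
  "scalar_mat a \<longleftrightarrow> (\<forall>i j. i \<noteq> j \<longrightarrow> a (i, j) = 0) \<and> (\<exists>c. \<forall>i. a (i, i) = c)"

definition U_set :: "('i \<Rightarrow> 'i \<Rightarrow> bool) \<Rightarrow> ('i, 'r::comm_ring_1) mat set" where
  "U_set leq = {a. nonsingular leq a \<and> upper_triangular leq a}"

definition AU_set :: "('i \<Rightarrow> 'i \<Rightarrow> bool) \<Rightarrow> ('i, 'r::comm_ring_1) mat set" where
  "AU_set leq = {a. nonsingular leq a \<and> almost_upper_triangular leq a}"

definition Z_set :: "('i \<Rightarrow> 'i \<Rightarrow> bool) \<Rightarrow> ('i, 'r::comm_ring_1) mat set" where
  "Z_set leq = {a. nonsingular leq a \<and> scalar_mat a}"

definition AU :: "('i \<Rightarrow> 'i \<Rightarrow> bool) \<Rightarrow> ('i, 'r::comm_ring_1) mat monoid" where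
  "AU leq = \<lparr>carrier = AU_set leq, mult = mat_mult, one = mat_one\<rparr>"


section \<open>Topologies\<close>

definition mat_topology :: "('i, 'r) mat topology" where
  "mat_topology = product_topology (\<lambda>_. discrete_topology UNIV) UNIV"

definition U_topology :: "('i \<Rightarrow> 'i \<Rightarrow> bool) \<Rightarrow> ('i, 'r::comm_ring_1) mat topology" where
  "U_topology leq = subtopology mat_topology (U_set leq)"

text \<open>
  For a \<open>\<int>\<close>-like preorder there is exactly one such topology: \<open>AU_set leq\<close> is the directed
  union of the sets \<open>U_set (pre_collapse leq S)\<close>, whose transition inclusions are open
  embeddings of topological groups.
\<close>

definition AU_topology :: "('i \<Rightarrow> 'i \<Rightarrow> bool) \<Rightarrow> ('i, 'r::comm_ring_1) mat topology" where
  "AU_topology leq =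
     (THE T. group_topology (AU leq) T \<and>
        (\<forall>S. finite S \<and> pre_convex leq S \<longrightarrow>
           continuous_map (U_topology (pre_collapse leq S)) T (\<lambda>a. a) \<and>
           open_map (U_topology (pre_collapse leq S)) T (\<lambda>a. a)))"

end

(*
  The set AU of almost upper triangular nonsingular matrices is the union of the unit groups
  U(leq + T) of the incidence algebras of leq + T, with T finite and strongly convex. In such an
  algebra the block of a product (or of an inverse) on a finite convex set is the product (or the
  inverse) of the blocks; this makes the sets of matrices agreeing with a on a finite block and
  below the diagonal a basis of neighbourhoods of a for the group topology.

  If x represents an element of the quasi-centre, then for some finite S it commutes up to a scalar
  with every transvection 1 + e_ij, i < j or i ~ j, that is trivial on S x S. The scalar must be 1,
  so off-diagonal entries in column i and in row j of x vanish and x_ii = x_jj. Given k and l, choose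
  m outside a finite strongly convex set containing S, k and l, which is possible as the index set is
  infinite; the pairs formed by m with k and l show x_kl = 0 for k distinct from l and x_kk = x_ll.
*)

theory Submission
  imports Defs
begin

section \<open>Finite blocks of upper triangular matrices\<close>

lemma strongly_convex_imp_pre_convex:
  assumes "strongly_convex leq S"
  shows "pre_convex leq S"
  using assms unfolding strongly_convex_def pre_convex_def pre_interval_def pre_less_def pre_equiv_def
  by blast

lemma upper_triangularD:
  "upper_triangular leq a \<Longrightarrow> a (i, j) \<noteq> 0 \<Longrightarrow> leq i j"
  by (auto simp: upper_triangular_def)

text \<open>A nonzero term needs \<open>k\<close> between \<open>i\<close> and \<open>j\<close>, and
  convexity puts such \<open>k\<close> into \<open>S\<close>. So the block of a product on a finite
  convex set is the product of the blocks.\<close>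

lemma mat_mult_eq_sum:
  assumes "upper_triangular leq a" "upper_triangular leq b" "finite S" "pre_convex leq S"
    and "i \<in> S" "j \<in> S"
  shows "mat_mult a b (i, j) = (\<Sum>k\<in>S. a (i, k) * b (k, j))"
proof -
  have "{k. a (i, k) * b (k, j) \<noteq> 0} \<subseteq> S"
  proof
    fix k assume "k \<in> {k. a (i, k) * b (k, j) \<noteq> 0}"
    then have "leq i k" "leq k j"
      using assms(1,2) by (auto intro: upper_triangularD)
    then show "k \<in> S"
      using assms(4-6) by (auto simp: pre_convex_def pre_interval_def)
  qed
  then show ?thesis
    using assms(3) by (simp add: mat_mult_def Sum_any.expand_superset)
qed

text \<open>The witness of \<open>invertible_block\<close> is made explicit so that inverses on
  different blocks can be compared.\<close>

definition block_inverse :: "'i set \<Rightarrow> ('i, 'r::comm_ring_1) mat \<Rightarrow> ('i, 'r) mat \<Rightarrow> bool" where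
  "block_inverse S a b \<longleftrightarrow>
     (\<forall>i\<in>S. \<forall>j\<in>S.
        (\<Sum>k\<in>S. a (i, k) * b (k, j)) = mat_one (i, j) \<and>
        (\<Sum>k\<in>S. b (i, k) * a (k, j)) = mat_one (i, j))"

lemma invertible_block_iff: "invertible_block S a \<longleftrightarrow> (\<exists>b. block_inverse S a b)"
  by (simp add: invertible_block_def block_inverse_def)

lemma sum_mat_one_left:
  "finite S \<Longrightarrow> i \<in> S \<Longrightarrow> (\<Sum>k\<in>S. mat_one (i, k) * f k) = f i"
  by (simp add: mat_one_def if_distrib[of "\<lambda>x. x * _"] cong: if_cong)

lemma sum_mat_one_right:
  "finite S \<Longrightarrow> j \<in> S \<Longrightarrow> (\<Sum>k\<in>S. f k * mat_one (k, j)) = f j"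
  by (simp add: mat_one_def if_distrib[of "\<lambda>x. _ * x"] cong: if_cong)

text \<open>Being a left inverse, in terms of vectors: it yields uniqueness of the block inverse and
  injectivity of multiplication by \<open>a\<close>.\<close>

lemma block_inverse_apply:
  assumes "block_inverse S a b" "finite S" "i \<in> S"
  shows "(\<Sum>k\<in>S. b (i, k) * (\<Sum>l\<in>S. a (k, l) * v l)) = v i"
proof -
  have "(\<Sum>k\<in>S. b (i, k) * (\<Sum>l\<in>S. a (k, l) * v l)) =
        (\<Sum>k\<in>S. \<Sum>l\<in>S. b (i, k) * a (k, l) * v l)"
    by (simp add: sum_distrib_left mult.assoc)
  also have "\<dots> = (\<Sum>l\<in>S. (\<Sum>k\<in>S. b (i, k) * a (k, l)) * v l)"
    by (subst sum.swap) (simp add: sum_distrib_right)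
  also have "\<dots> = (\<Sum>l\<in>S. mat_one (i, l) * v l)"
    using assms by (intro sum.cong) (auto simp: block_inverse_def)
  finally show ?thesis
    using assms by (simp add: sum_mat_one_left)
qed

text \<open>On the block, c = (ba)c = b(ac) = b.\<close>

lemma block_inverse_unique:
  assumes b: "block_inverse S a b" and c: "block_inverse S a c"
    and S: "finite S" "i \<in> S" "j \<in> S"
  shows "b (i, j) = c (i, j)"
proof -
  have "c (i, j) = (\<Sum>k\<in>S. b (i, k) * (\<Sum>l\<in>S. a (k, l) * c (l, j)))"
    using block_inverse_apply[OF b S(1,2), of "\<lambda>l. c (l, j)"] by simp
  also have "\<dots> = (\<Sum>k\<in>S. b (i, k) * mat_one (k, j))"
    using c S by (intro sum.cong) (auto simp: block_inverse_def)
  finally show ?thesis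
    using S by (simp add: sum_mat_one_right)
qed

text \<open>
  Multiplication by \<open>a\<close> is an injective self-map of the finite set of vectors supported on
  \<open>{k \<in> S. leq k j}\<close>, hence surjective; so the \<open>j\<close>-th column of the inverse is supported there.
\<close>

lemma block_inverse_upper_triangular:
  fixes a b :: "('i, 'k::{field, finite}) mat"
  assumes leq: "is_preorder leq" and a: "upper_triangular leq a"
    and b: "block_inverse S a b" and S: "finite S" "i \<in> S" "j \<in> S" and "\<not> leq i j"
  shows "b (i, j) = 0"
proof -
  define D where "D = {k \<in> S. leq k j}"
  define X where "X = {v :: 'i \<Rightarrow> 'k. \<forall>k. (k \<in> D \<longrightarrow> v k \<in> UNIV) \<and> (k \<notin> D \<longrightarrow> v k = 0)}"
  define \<phi> where "\<phi> v = (\<lambda>k. if k \<in> S then \<Sum>l\<in>S. a (k, l) * v l else 0)" for v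
  have "finite X"
    unfolding X_def by (rule finite_set_of_finite_funs) (auto simp: D_def S)
  moreover have "\<phi> ` X \<subseteq> X"
  proof -
    have "\<phi> v k = 0" if v: "v \<in> X" and "k \<notin> D" for v k
    proof (cases "k \<in> S")
      case True
      then have "\<not> leq k j" using that by (simp add: D_def)
      have "a (k, l) * v l = 0" for l
      proof (rule ccontr)
        assume "a (k, l) * v l \<noteq> 0"
        then have "a (k, l) \<noteq> 0" "l \<in> D" using v by (auto simp: X_def)
        then have "leq k l" "leq l j" using a by (auto simp: D_def intro: upper_triangularD)
        then show False
          using leq \<open>\<not> leq k j\<close> by (auto simp: is_preorder_def dest: transpD)
      qed
      then show ?thesis unfolding \<phi>_def by (simp only: sum.neutral_const if_cancel)
    qed (simp add: \<phi>_def)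
    then show ?thesis by (auto simp: X_def)
  qed
  moreover have app: "v k = (\<Sum>l\<in>S. b (k, l) * \<phi> v l)" if "k \<in> S" for v k
    using block_inverse_apply[OF b S(1) that, of v] by (simp add: \<phi>_def)
  have "inj_on \<phi> X"
  proof (rule inj_onI, rule ext)
    fix v w k assume vw: "v \<in> X" "w \<in> X" "\<phi> v = \<phi> w"
    show "v k = w k"
    proof (cases "k \<in> S")
      case True
      then show ?thesis using app[of k v] app[of k w] vw by simp
    next
      case False
      then have "k \<notin> D" by (simp add: D_def)
      then show ?thesis using vw by (simp add: X_def)
    qed
  qed
  ultimately have "\<phi> ` X = X" by (rule endo_inj_surj)
  moreover have "(\<lambda>k. mat_one (k, j)) \<in> X"
    using S leq by (auto simp: X_def D_def mat_one_def is_preorder_def dest: reflpD)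
  ultimately obtain v where v: "v \<in> X" "\<phi> v = (\<lambda>k. mat_one (k, j))"
    by (metis (no_types, lifting) imageE)
  have "b (i, j) = v i"
    using app[OF S(2), of v] v(2) S by (simp add: sum_mat_one_right)
  also have "\<dots> = 0"
    using v(1) \<open>\<not> leq i j\<close> by (simp add: X_def D_def)
  finally show ?thesis .
qed

text \<open>For \<open>i\<close>, \<open>j\<close> in \<open>S\<close> and \<open>k\<close> in
  \<open>S' - S\<close>, convexity excludes that \<open>k\<close> lies between \<open>i\<close> and
  \<open>j\<close>. Since \<open>b\<close> is upper triangular on \<open>S'\<close> as well, these
  terms vanish and the sums over \<open>S'\<close> reduce to sums over \<open>S\<close>.\<close>

lemma block_inverse_subset:
  fixes a b :: "('i, 'k::{field, finite}) mat"
  assumes leq: "is_preorder leq" and a: "upper_triangular leq a"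
    and b: "block_inverse S' a b" and S: "finite S'" "S \<subseteq> S'" "pre_convex leq S"
  shows "block_inverse S a b"
proof -
  have "(\<Sum>k\<in>S. a (i, k) * b (k, j)) = (\<Sum>k\<in>S'. a (i, k) * b (k, j)) \<and>
        (\<Sum>k\<in>S. b (i, k) * a (k, j)) = (\<Sum>k\<in>S'. b (i, k) * a (k, j))"
    if ij: "i \<in> S" "j \<in> S" for i j
  proof -
    have b0: "b (k, l) = 0" if "k \<in> S'" "l \<in> S'" "\<not> leq k l" for k l
      using block_inverse_upper_triangular[OF leq a b S(1)] that by blast
    have out: "\<not> leq i k \<or> \<not> leq k j" if "k \<in> S' - S" for k
      using that ij S by (auto simp: pre_convex_def pre_interval_def)
    have zero: "a (i, k) * b (k, j) = 0 \<and> b (i, k) * a (k, j) = 0" if "k \<in> S' - S" for k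
      using out[OF that] b0[of i k] b0[of k j] a that ij S by (auto simp: upper_triangular_def)
    show ?thesis
      using S zero by (intro conjI sum.mono_neutral_left) blast+
  qed
  then show ?thesis
    using b S by (simp add: block_inverse_def subset_iff)
qed

section \<open>Unit groups of incidence algebras\<close>

locale Z_like_preorder =
  fixes leq :: "'i \<Rightarrow> 'i \<Rightarrow> bool"
  assumes preorder: "is_preorder leq" and Z_like: "Z_like leq"
begin

lemma leq_refl [simp]: "leq i i"
  using preorder by (auto simp: is_preorder_def dest: reflpD)

lemma leq_trans: "leq i j \<Longrightarrow> leq j k \<Longrightarrow> leq i k"
  using preorder by (auto simp: is_preorder_def dest: transpD)

lemma strongly_convex_hull:
  assumes "finite F"
  obtains S where "F \<subseteq> S" "finite S" "strongly_convex leq S"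
  using assms Z_like unfolding Z_like_def by blast

lemma convex_hull:
  assumes "finite F"
  obtains S where "F \<subseteq> S" "finite S" "pre_convex leq S"
  using assms by (meson strongly_convex_hull strongly_convex_imp_pre_convex)

lemma upper_triangular_mat_one: "upper_triangular leq mat_one"
  by (auto simp: upper_triangular_def mat_one_def)

lemma upper_triangular_mat_mult:
  assumes a: "upper_triangular leq a" and b: "upper_triangular leq b"
  shows "upper_triangular leq (mat_mult a b)"
  unfolding upper_triangular_def
proof (intro allI impI)
  fix i j assume "\<not> leq i j"
  then have "\<not> leq i k \<or> \<not> leq k j" for k
    using leq_trans by blast
  then have "a (i, k) * b (k, j) = 0" for k
    using a b by (metis mult_zero_left mult_zero_right upper_triangularD)
  then show "mat_mult a b (i, j) = 0"
    by (simp add: mat_mult_def)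
qed

lemma mat_mult_one_left: "upper_triangular leq a \<Longrightarrow> mat_mult mat_one a = a"
proof (rule ext, clarify)
  fix i j assume a: "upper_triangular leq a"
  obtain S where S: "{i, j} \<subseteq> S" "finite S" "pre_convex leq S"
    by (rule convex_hull[of "{i, j}"]) auto
  show "mat_mult mat_one a (i, j) = a (i, j)"
    using S by (subst mat_mult_eq_sum[OF upper_triangular_mat_one a S(2,3)])
      (auto simp: sum_mat_one_left)
qed

text \<open>A finite convex set containing \<open>i\<close> and \<open>j\<close> turns all sums for
  this entry into finite ones, which may be exchanged.\<close>

lemma mat_mult_assoc:
  assumes a: "upper_triangular leq a" and b: "upper_triangular leq b"
    and c: "upper_triangular leq c"
  shows "mat_mult (mat_mult a b) c = mat_mult a (mat_mult b c)"
proof (rule ext, clarify)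
  fix i j
  obtain S where S: "{i, j} \<subseteq> S" "finite S" "pre_convex leq S"
    by (rule convex_hull[of "{i, j}"]) auto
  have "mat_mult (mat_mult a b) c (i, j) = (\<Sum>k\<in>S. mat_mult a b (i, k) * c (k, j))"
    using S by (intro mat_mult_eq_sum[OF upper_triangular_mat_mult[OF a b] c]) auto
  also have "\<dots> = (\<Sum>k\<in>S. \<Sum>l\<in>S. a (i, l) * b (l, k) * c (k, j))"
    using S by (intro sum.cong) (auto simp: mat_mult_eq_sum[OF a b S(2,3)] sum_distrib_right)
  also have "\<dots> = (\<Sum>l\<in>S. \<Sum>k\<in>S. a (i, l) * b (l, k) * c (k, j))"
    by (rule sum.swap)
  also have "\<dots> = (\<Sum>l\<in>S. a (i, l) * mat_mult b c (l, j))"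
    using S by (intro sum.cong) (auto simp: mat_mult_eq_sum[OF b c S(2,3)] sum_distrib_left mult.assoc)
  also have "\<dots> = mat_mult a (mat_mult b c) (i, j)"
    using S by (intro mat_mult_eq_sum[OF a upper_triangular_mat_mult[OF b c], symmetric]) auto
  finally show "mat_mult (mat_mult a b) c (i, j) = mat_mult a (mat_mult b c) (i, j)" .
qed

lemma block_inverseI:
  assumes a: "upper_triangular leq a" and b: "upper_triangular leq b"
    and "mat_mult a b = mat_one" "mat_mult b a = mat_one"
    and S: "finite S" "pre_convex leq S"
  shows "block_inverse S a b"
  unfolding block_inverse_def
  by (simp add: assms(3,4) mat_mult_eq_sum[OF a b S, symmetric] mat_mult_eq_sum[OF b a S, symmetric])

lemma U_setI:
  assumes a: "upper_triangular leq a" and b: "upper_triangular leq b"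
    and "mat_mult a b = mat_one" "mat_mult b a = mat_one"
  shows "a \<in> U_set leq"
proof -
  have "block_inverse S a b" if "finite S" "pre_convex leq S" for S
    using block_inverseI assms that by blast
  \<comment> \<open>All finite convex blocks are invertible, so the threshold in
    \<open>nonsingular\<close> can be the empty set.\<close>
  moreover have "pre_convex leq {}" by (simp add: pre_convex_def)
  ultimately have "nonsingular leq a"
    unfolding nonsingular_def invertible_block_iff by blast
  with a show ?thesis by (simp add: U_set_def)
qed

text \<open>The inverse is glued from inverses of finite blocks, which agree on overlaps because
  both are restrictions of the inverse on a larger block.\<close>

lemma U_set_inverse:
  fixes a :: "('i, 'k::{field, finite}) mat"
  assumes "a \<in> U_set leq"
  obtains b where "b \<in> U_set leq" "mat_mult a b = mat_one" "mat_mult b a = mat_one"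
proof -
  have a: "upper_triangular leq a" using assms by (simp add: U_set_def)
  obtain S0 where S0: "finite S0"
    and inv: "\<And>S. finite S \<Longrightarrow> pre_convex leq S \<Longrightarrow> S0 \<subseteq> S \<Longrightarrow> \<exists>b. block_inverse S a b"
    using assms unfolding U_set_def nonsingular_def invertible_block_iff by blast
  \<comment> \<open>Each pair gets its own convex set \<open>H i j\<close> beyond the threshold
    \<open>S0\<close>; the entry of \<open>b\<close> at that pair is read off the inverse of this
    block.\<close>
  have "\<exists>S. S0 \<union> {i, j} \<subseteq> S \<and> finite S \<and> pre_convex leq S" for i j
    by (rule convex_hull[of "S0 \<union> {i, j}"]) (use S0 in auto)
  then obtain H where H: "S0 \<union> {i, j} \<subseteq> H i j" "finite (H i j)" "pre_convex leq (H i j)" for i j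
    by metis
  have "\<exists>b. block_inverse (H i j) a b" for i j
    using H[where i=i and j=j] by (intro inv) auto
  then obtain B where B: "block_inverse (H i j) a (B i j)" for i j by metis
  define b where "b = (\<lambda>(i, j). B i j (i, j))"
  have block: "block_inverse S a b" if S: "finite S" "pre_convex leq S" "S0 \<subseteq> S" for S
  proof -
    obtain c where c: "block_inverse S a c" using inv S by blast
    have "b (i, j) = c (i, j)" if ij: "i \<in> S" "j \<in> S" for i j
    proof -
      \<comment> \<open>A convex set containing both blocks: its inverse \<open>d\<close> restricts
        to an inverse on \<open>S\<close> and on \<open>H i j\<close>, and uniqueness identifies all
        three at the entry.\<close>
      obtain S' where S': "S \<union> H i j \<subseteq> S'" "finite S'" "pre_convex leq S'"
        by (rule convex_hull[of "S \<union> H i j"]) (use S H in auto)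
      obtain d where d: "block_inverse S' a d" using inv[of S'] S' S by auto
      have "block_inverse S a d" "block_inverse (H i j) a d"
        using block_inverse_subset[OF preorder a d S'(2)] S' S H by auto
      then have "c (i, j) = d (i, j)" "B i j (i, j) = d (i, j)"
        using block_inverse_unique[OF c _ S(1) ij, of d] block_inverse_unique[OF B, of i j d i j] H[of i j]
        by auto
      then show ?thesis by (simp add: b_def)
    qed
    then have "(\<Sum>k\<in>S. a (i, k) * b (k, j)) = (\<Sum>k\<in>S. a (i, k) * c (k, j)) \<and>
        (\<Sum>k\<in>S. b (i, k) * a (k, j)) = (\<Sum>k\<in>S. c (i, k) * a (k, j))" if "i \<in> S" "j \<in> S" for i j
      using that by simp
    then show ?thesis using c by (simp add: block_inverse_def)
  qed
  have b: "upper_triangular leq b"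
    unfolding upper_triangular_def
  proof (intro allI impI)
    fix i j assume "\<not> leq i j"
    then have "B i j (i, j) = 0"
      using block_inverse_upper_triangular[OF preorder a B H(2)] H(1)[of i j] by auto
    then show "b (i, j) = 0" by (simp add: b_def)
  qed
  have "mat_mult a b (i, j) = mat_one (i, j) \<and> mat_mult b a (i, j) = mat_one (i, j)" for i j
    using mat_mult_eq_sum[OF a b H(2,3), of i i j j] mat_mult_eq_sum[OF b a H(2,3), of i i j j]
      block[OF H(2,3), of i j] H(1)[of i j] by (simp add: block_inverse_def)
  then have ab: "mat_mult a b = mat_one" "mat_mult b a = mat_one" by auto
  show thesis
    by (rule that[OF U_setI[OF b a ab(2,1)] ab])
qed

lemma mat_one_in_U_set: "mat_one \<in> U_set leq"
  by (intro U_setI[OF upper_triangular_mat_one upper_triangular_mat_one]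
      mat_mult_one_left upper_triangular_mat_one)

text \<open>Nonsingularity of the product comes from its inverse \<open>mat_mult b' a'\<close>,
  which is again upper triangular.\<close>

lemma mat_mult_in_U_set:
  fixes a b :: "('i, 'k::{field, finite}) mat"
  assumes "a \<in> U_set leq" "b \<in> U_set leq"
  shows "mat_mult a b \<in> U_set leq"
proof -
  obtain a' b' where a': "a' \<in> U_set leq" "mat_mult a a' = mat_one" "mat_mult a' a = mat_one"
    and b': "b' \<in> U_set leq" "mat_mult b b' = mat_one" "mat_mult b' b = mat_one"
    using U_set_inverse assms by metis
  have ut: "upper_triangular leq a" "upper_triangular leq b"
    "upper_triangular leq a'" "upper_triangular leq b'"
    using assms a' b' by (auto simp: U_set_def)
  note rules = upper_triangular_mat_mult ut
  have "mat_mult (mat_mult a b) (mat_mult b' a') = mat_mult a (mat_mult (mat_mult b b') a')"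
    by (simp add: mat_mult_assoc rules)
  moreover have "mat_mult (mat_mult b' a') (mat_mult a b) = mat_mult b' (mat_mult (mat_mult a' a) b)"
    by (simp add: mat_mult_assoc rules)
  ultimately show ?thesis
    by (intro U_setI[of _ "mat_mult b' a'"]) (simp_all add: rules a' b' mat_mult_one_left)
qed

section \<open>The preorder of leq + S and its unit groups\<close>

lemma pre_collapse_iff:
  "pre_collapse leq S i j \<longleftrightarrow> leq i j \<or> (\<exists>s\<in>S. \<exists>t\<in>S. leq i s \<and> leq t j)"
proof
  \<comment> \<open>Any chain shortens to at most one jump inside \<open>S\<close>, from its first
    entry into \<open>S\<close> to its last exit.\<close>
  show "leq i j \<or> (\<exists>s\<in>S. \<exists>t\<in>S. leq i s \<and> leq t j)" if "pre_collapse leq S i j"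
    using that unfolding pre_collapse_def
    by (induction rule: rtranclp_induct) (use leq_refl leq_trans in blast)+
  assume "leq i j \<or> (\<exists>s\<in>S. \<exists>t\<in>S. leq i s \<and> leq t j)"
  then show "pre_collapse leq S i j"
  proof
    assume "leq i j"
    then show ?thesis by (auto simp: pre_collapse_def)
  next
    assume "\<exists>s\<in>S. \<exists>t\<in>S. leq i s \<and> leq t j"
    then obtain s t where "s \<in> S" "t \<in> S" "leq i s" "leq t j" by blast
    define R where "R = (\<lambda>i j. leq i j \<or> i \<in> S \<and> j \<in> S)"
    have "R i s" "R s t" "R t j"
      using \<open>s \<in> S\<close> \<open>t \<in> S\<close> \<open>leq i s\<close> \<open>leq t j\<close> by (auto simp: R_def)
    then have "R\<^sup>*\<^sup>* i j"
      by (meson converse_rtranclp_into_rtranclp r_into_rtranclp)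
    then show ?thesis by (simp add: pre_collapse_def R_def)
  qed
qed

lemma strongly_convexE:
  assumes "strongly_convex leq T" "i \<notin> T"
  obtains (below) "\<And>t. t \<in> T \<Longrightarrow> leq i t" "\<And>t. t \<in> T \<Longrightarrow> \<not> leq t i"
    | (above) "\<And>t. t \<in> T \<Longrightarrow> leq t i" "\<And>t. t \<in> T \<Longrightarrow> \<not> leq i t"
  using assms unfolding strongly_convex_def pre_less_def pre_equiv_def by blast

text \<open>A point outside \<open>T\<close> lies strictly below or strictly above all of
  \<open>T\<close>. Reversing this in the collapsed preorder would require a relation with a point
  of \<open>S\<close> that \<open>leq\<close> already excludes.\<close>

lemma strongly_convex_pre_collapse:
  assumes T: "strongly_convex leq T" and "S \<subseteq> T"
  shows "strongly_convex (pre_collapse leq S) T"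
  unfolding strongly_convex_def
proof
  fix i assume "i \<in> UNIV - T"
  then have "i \<notin> T" by simp
  with T show "(\<forall>j\<in>T. pre_less (pre_collapse leq S) i j) \<or> (\<forall>j\<in>T. pre_less (pre_collapse leq S) j i)"
  proof (cases rule: strongly_convexE)
    case below
    then show ?thesis
      using \<open>S \<subseteq> T\<close> by (auto simp: pre_less_def pre_equiv_def pre_collapse_iff)
  next
    case above
    then show ?thesis
      using \<open>S \<subseteq> T\<close> by (auto simp: pre_less_def pre_equiv_def pre_collapse_iff)
  qed
qed

text \<open>This makes every result of the locale available for leq + S.\<close>

lemma Z_like_preorder_pre_collapse:
  assumes "finite S"
  shows "Z_like_preorder (pre_collapse leq S)"
proof
  show "is_preorder (pre_collapse leq S)"
    by (auto simp: is_preorder_def pre_collapse_def reflp_def transp_def)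
  show "Z_like (pre_collapse leq S)"
    unfolding Z_like_def
  proof (intro allI impI)
    fix F :: "'i set" assume "finite F"
    then obtain T where "F \<union> S \<subseteq> T" "finite T" "strongly_convex leq T"
      by (metis assms finite_Un strongly_convex_hull)
    then show "\<exists>T. F \<subseteq> T \<and> finite T \<and> strongly_convex (pre_collapse leq S) T"
      using strongly_convex_pre_collapse by blast
  qed
qed

text \<open>The new relations live in \<open>T \<times> T\<close>: if \<open>i\<close> is outside
  \<open>T\<close> and below some \<open>s\<close> in \<open>T\<close>, it is below all of
  \<open>T\<close>, so \<open>leq i t\<close> and \<open>leq t j\<close> already give
  \<open>leq i j\<close>; dually for \<open>j\<close>.\<close>

lemma pre_collapse_mem:
  assumes "strongly_convex leq T" "S \<subseteq> T" "pre_collapse leq S i j" "\<not> leq i j"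
  shows "i \<in> T" "j \<in> T"
proof -
  obtain s t where st: "s \<in> T" "t \<in> T" "leq i s" "leq t j"
    using assms(2-4) by (auto simp: pre_collapse_iff)
  show "i \<in> T"
  proof (rule ccontr)
    assume "i \<notin> T"
    with assms(1) show False
      by (rule strongly_convexE) (use st assms(4) leq_trans in blast)+
  qed
  show "j \<in> T"
  proof (rule ccontr)
    assume "j \<notin> T"
    with assms(1) show False
      by (rule strongly_convexE) (use st assms(4) leq_trans in blast)+
  qed
qed

text \<open>A point between two elements of \<open>T\<close> for the collapsed preorder is also
  between two elements of \<open>T\<close> for \<open>leq\<close>, possibly different ones taken
  from \<open>S\<close>.\<close>

lemma pre_convex_pre_collapse_iff:
  assumes "S \<subseteq> T"
  shows "pre_convex (pre_collapse leq S) T \<longleftrightarrow> pre_convex leq T"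
proof
  show "pre_convex leq T" if "pre_convex (pre_collapse leq S) T"
    using that by (fastforce simp: pre_convex_def pre_interval_def pre_collapse_iff)
  assume T: "pre_convex leq T"
  show "pre_convex (pre_collapse leq S) T"
    unfolding pre_convex_def pre_interval_def
  proof safe
    fix i j k assume ij: "i \<in> T" "j \<in> T" "pre_collapse leq S i k" "pre_collapse leq S k j"
    then obtain s t where "s \<in> T" "leq s k" "t \<in> T" "leq k t"
      using assms by (auto simp: pre_collapse_iff)
    then show "k \<in> T"
      using T by (auto simp: pre_convex_def pre_interval_def)
  qed
qed

text \<open>Enlarging the threshold, only blocks containing \<open>S\<close> need testing, and for
  these the two notions of convexity agree.\<close>

lemma nonsingular_pre_collapse_iff:
  assumes "finite S"
  shows "nonsingular (pre_collapse leq S) a \<longleftrightarrow> nonsingular leq a"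
proof -
  have *: "nonsingular P a \<longleftrightarrow> (\<exists>T. finite T \<and> S \<subseteq> T \<and> pre_convex P T \<and>
      (\<forall>T'. finite T' \<and> pre_convex P T' \<and> T \<subseteq> T' \<longrightarrow> invertible_block T' a))"
    if "Z_like_preorder P" for P :: "'i \<Rightarrow> 'i \<Rightarrow> bool"
  proof
    interpret P: Z_like_preorder P by fact
    assume "nonsingular P a"
    then obtain T0 where T0: "finite T0"
      "\<And>T'. finite T' \<Longrightarrow> pre_convex P T' \<Longrightarrow> T0 \<subseteq> T' \<Longrightarrow> invertible_block T' a"
      by (auto simp: nonsingular_def)
    obtain T where "T0 \<union> S \<subseteq> T" "finite T" "pre_convex P T"
      by (rule P.convex_hull[of "T0 \<union> S"]) (use T0 assms in auto)
    then show "\<exists>T. finite T \<and> S \<subseteq> T \<and> pre_convex P T \<and>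
      (\<forall>T'. finite T' \<and> pre_convex P T' \<and> T \<subseteq> T' \<longrightarrow> invertible_block T' a)"
      by (intro exI[of _ T]) (auto intro: T0)
  qed (auto simp: nonsingular_def)
  show ?thesis
    unfolding *[OF Z_like_preorder_axioms] *[OF Z_like_preorder_pre_collapse[OF assms]]
    by (meson pre_convex_pre_collapse_iff subset_trans)
qed

text \<open>The nonzero entries with \<open>\<not> leq i j\<close> are confined to
  \<open>T \<times> T\<close> for a finite strongly convex \<open>T\<close> containing
  \<open>S\<close>.\<close>

lemma U_set_pre_collapse_iff:
  assumes "finite S"
  shows "a \<in> U_set (pre_collapse leq S) \<longleftrightarrow>
    a \<in> AU_set leq \<and> upper_triangular (pre_collapse leq S) a"
proof -
  have "almost_upper_triangular leq a" if "upper_triangular (pre_collapse leq S) a"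
  proof -
    obtain T where T: "S \<subseteq> T" "finite T" "strongly_convex leq T"
      using assms by (rule strongly_convex_hull)
    have "{(i, j). \<not> leq i j \<and> a (i, j) \<noteq> 0} \<subseteq> T \<times> T"
      using pre_collapse_mem[OF T(3,1)] upper_triangularD[OF that] by blast
    then show ?thesis
      unfolding almost_upper_triangular_def by (rule finite_subset) (use T in auto)
  qed
  then show ?thesis
    by (auto simp: U_set_def AU_set_def nonsingular_pre_collapse_iff[OF assms])
qed

text \<open>This is the directed union: finitely many matrices have finitely many entries that
  violate triangularity, and \<open>T\<close> is chosen to contain all their row and column
  indices.\<close>

lemma AU_set_hull:
  assumes "finite A" "A \<subseteq> AU_set leq" "finite F"
  obtains T where "F \<subseteq> T" "finite T" "strongly_convex leq T" "A \<subseteq> U_set (pre_collapse leq T)"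
proof -
  define B where "B = (\<Union>a\<in>A. {(i, j). \<not> leq i j \<and> a (i, j) \<noteq> 0})"
  have "finite B"
    using assms by (auto simp: B_def AU_set_def almost_upper_triangular_def)
  then obtain T where T: "F \<union> fst ` B \<union> snd ` B \<subseteq> T" "finite T" "strongly_convex leq T"
    using assms(3) by (metis finite_Un finite_imageI strongly_convex_hull)
  have "upper_triangular (pre_collapse leq T) a" if "a \<in> A" for a
    unfolding upper_triangular_def
  proof (intro allI impI, rule ccontr)
    fix i j assume ij: "\<not> pre_collapse leq T i j" "a (i, j) \<noteq> 0"
    then have "(i, j) \<in> B"
      using that by (auto simp: B_def pre_collapse_iff)
    then have "i \<in> T" "j \<in> T" using T(1) by force+
    then show False using ij(1) leq_refl unfolding pre_collapse_iff by blast
  qed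
  then have "A \<subseteq> U_set (pre_collapse leq T)"
    using assms(2) U_set_pre_collapse_iff[OF T(2)] by blast
  then show thesis using T by (intro that) auto
qed

section \<open>Group structure on the directed union\<close>

lemma group_AU: "group (AU leq :: ('i, 'k::{field, finite}) mat monoid)"
proof (rule groupI)
  fix x y z :: "('i, 'k) mat"
  assume "x \<in> carrier (AU leq)" "y \<in> carrier (AU leq)" "z \<in> carrier (AU leq)"
  \<comment> \<open>Three elements lie in a common unit group U(leq + T), where the group laws are
    known.\<close>
  then obtain T where T: "finite T" "{x, y, z} \<subseteq> U_set (pre_collapse leq T)"
    by (auto simp: AU_def intro: AU_set_hull[of "{x, y, z}" "{}"])
  interpret T: Z_like_preorder "pre_collapse leq T"
    by (rule Z_like_preorder_pre_collapse) fact
  have ut: "upper_triangular (pre_collapse leq T) x" "upper_triangular (pre_collapse leq T) y"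
    "upper_triangular (pre_collapse leq T) z"
    using T by (auto simp: U_set_def)
  have "mat_mult x y \<in> U_set (pre_collapse leq T)"
    using T by (intro T.mat_mult_in_U_set) auto
  then show "x \<otimes>\<^bsub>AU leq\<^esub> y \<in> carrier (AU leq)"
    using T(1) by (simp add: AU_def U_set_pre_collapse_iff)
  show "x \<otimes>\<^bsub>AU leq\<^esub> y \<otimes>\<^bsub>AU leq\<^esub> z = x \<otimes>\<^bsub>AU leq\<^esub> (y \<otimes>\<^bsub>AU leq\<^esub> z)"
    using ut by (simp add: AU_def T.mat_mult_assoc)
  show "\<one>\<^bsub>AU leq\<^esub> \<otimes>\<^bsub>AU leq\<^esub> x = x"
    using ut by (simp add: AU_def T.mat_mult_one_left)
  obtain x' where "x' \<in> U_set (pre_collapse leq T)" "mat_mult x' x = mat_one"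
    using T T.U_set_inverse[of x] by auto
  then show "\<exists>x'\<in>carrier (AU leq). x' \<otimes>\<^bsub>AU leq\<^esub> x = \<one>\<^bsub>AU leq\<^esub>"
    using T(1) by (auto simp: AU_def U_set_pre_collapse_iff)
next
  have "(mat_one :: ('i, 'k) mat) \<in> U_set (pre_collapse leq {})"
    by (rule Z_like_preorder.mat_one_in_U_set[OF Z_like_preorder_pre_collapse]) simp
  then show "\<one>\<^bsub>AU leq\<^esub> \<in> carrier (AU leq :: ('i, 'k) mat monoid)"
    by (simp add: AU_def U_set_pre_collapse_iff)
qed

lemma inv_AU:
  fixes a :: "('i, 'k::{field, finite}) mat"
  assumes "finite T" "a \<in> U_set (pre_collapse leq T)"
  shows "inv\<^bsub>AU leq\<^esub> a \<in> U_set (pre_collapse leq T)"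
    "mat_mult a (inv\<^bsub>AU leq\<^esub> a) = mat_one" "mat_mult (inv\<^bsub>AU leq\<^esub> a) a = mat_one"
proof -
  interpret T: Z_like_preorder "pre_collapse leq T"
    by (rule Z_like_preorder_pre_collapse) fact
  obtain b where b: "b \<in> U_set (pre_collapse leq T)" "mat_mult a b = mat_one" "mat_mult b a = mat_one"
    using assms(2) by (rule T.U_set_inverse)
  have "inv\<^bsub>AU leq\<^esub> a = b"
    using group.inv_equality[OF group_AU, of b a] b assms
    by (simp add: AU_def U_set_pre_collapse_iff)
  with b show "inv\<^bsub>AU leq\<^esub> a \<in> U_set (pre_collapse leq T)"
    "mat_mult a (inv\<^bsub>AU leq\<^esub> a) = mat_one" "mat_mult (inv\<^bsub>AU leq\<^esub> a) a = mat_one"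
    by simp_all
qed

end

section \<open>The topology of almost upper triangular matrices\<close>

text \<open>The finitely many coordinates restricted by a basic open set lie in a square
  \<open>S \<times> S\<close>; conversely, fixing finitely many entries is open because the factors
  are discrete.\<close>

lemma openin_mat_topology:
  "openin mat_topology W \<longleftrightarrow>
    (\<forall>a\<in>W. \<exists>S. finite S \<and> {b. \<forall>i\<in>S. \<forall>j\<in>S. b (i, j) = a (i, j)} \<subseteq> W)"
proof
  assume W: "openin mat_topology W"
  show "\<forall>a\<in>W. \<exists>S. finite S \<and> {b. \<forall>i\<in>S. \<forall>j\<in>S. b (i, j) = a (i, j)} \<subseteq> W"
  proof
    fix a assume "a \<in> W"
    then obtain U where U: "finite {p. U p \<noteq> UNIV}" "a \<in> Pi\<^sub>E UNIV U" "Pi\<^sub>E UNIV U \<subseteq> W"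
      using W unfolding mat_topology_def openin_product_topology_alt by auto
    define S where "S = fst ` {p. U p \<noteq> UNIV} \<union> snd ` {p. U p \<noteq> UNIV}"
    have "b \<in> Pi\<^sub>E UNIV U" if b: "\<forall>i\<in>S. \<forall>j\<in>S. b (i, j) = a (i, j)" for b
    proof -
      have "b p \<in> U p" for p
      proof (cases "U p = UNIV")
        case False
        then have "fst p \<in> S" "snd p \<in> S" by (auto simp: S_def)
        then have "b p = a p" using b by (metis prod.collapse)
        then show ?thesis using U(2) by auto
      qed auto
      then show ?thesis by auto
    qed
    with U(1,3) show "\<exists>S. finite S \<and> {b. \<forall>i\<in>S. \<forall>j\<in>S. b (i, j) = a (i, j)} \<subseteq> W"
      by (intro exI[of _ S]) (auto simp: S_def)
  qed
next
  assume W: "\<forall>a\<in>W. \<exists>S. finite S \<and> {b. \<forall>i\<in>S. \<forall>j\<in>S. b (i, j) = a (i, j)} \<subseteq> W"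
  show "openin mat_topology W"
    unfolding mat_topology_def openin_product_topology_alt
  proof (intro conjI ballI)
    fix a assume "a \<in> W"
    then obtain S where S: "finite S" "{b. \<forall>i\<in>S. \<forall>j\<in>S. b (i, j) = a (i, j)} \<subseteq> W"
      using W by blast
    define U where "U p = (if p \<in> S \<times> S then {a p} else UNIV)" for p
    have "finite {p. U p \<noteq> UNIV}"
      by (rule finite_subset[of _ "S \<times> S"]) (auto simp: U_def S split: if_splits)
    moreover have "Pi\<^sub>E UNIV U \<subseteq> {b. \<forall>i\<in>S. \<forall>j\<in>S. b (i, j) = a (i, j)}"
    proof clarify
      fix b i j assume "b \<in> Pi\<^sub>E UNIV U" "i \<in> S" "j \<in> S"
      then have "b (i, j) \<in> U (i, j)" by auto
      then show "b (i, j) = a (i, j)" using \<open>i \<in> S\<close> \<open>j \<in> S\<close> by (simp add: U_def)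
    qed
    ultimately show "\<exists>U. finite {i \<in> UNIV. U i \<noteq> topspace (discrete_topology UNIV)} \<and>
        (\<forall>i\<in>UNIV. openin (discrete_topology UNIV) (U i)) \<and> a \<in> Pi\<^sub>E UNIV U \<and> Pi\<^sub>E UNIV U \<subseteq> W"
      using S(2) by (intro exI[of _ U]) (auto simp: U_def)
  qed
qed

lemma topspace_U_topology [simp]:
  "topspace (U_topology leq :: ('a, 'b::comm_ring_1) mat topology) = U_set leq"
proof -
  have "topspace (mat_topology :: ('a, 'b) mat topology) = UNIV"
    by (simp add: mat_topology_def)
  then show ?thesis by (simp add: U_topology_def)
qed

lemma openin_U_topology:
  "openin (U_topology leq) V \<longleftrightarrow> V \<subseteq> U_set leq \<and>
    (\<forall>a\<in>V. \<exists>S. finite S \<and> {b \<in> U_set leq. \<forall>i\<in>S. \<forall>j\<in>S. b (i, j) = a (i, j)} \<subseteq> V)"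
  (is "_ \<longleftrightarrow> ?R")
proof
  assume "openin (U_topology leq) V"
  then obtain W where W: "openin mat_topology W" and V: "V = W \<inter> U_set leq"
    by (auto simp: U_topology_def openin_subtopology)
  show ?R
  proof (intro conjI ballI)
    fix a assume "a \<in> V"
    then obtain S where "finite S" "{b. \<forall>i\<in>S. \<forall>j\<in>S. b (i, j) = a (i, j)} \<subseteq> W"
      using W V by (auto simp: openin_mat_topology)
    then show "\<exists>S. finite S \<and> {b \<in> U_set leq. \<forall>i\<in>S. \<forall>j\<in>S. b (i, j) = a (i, j)} \<subseteq> V"
      unfolding V by (intro exI[of _ S]) auto
  qed (use V in blast)
next
  assume R: ?R
  obtain S where "\<forall>a\<in>V. finite (S a) \<and> {b \<in> U_set leq. \<forall>i\<in>S a. \<forall>j\<in>S a. b (i, j) = a (i, j)} \<subseteq> V"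
    using bchoice[OF conjunct2[OF R]] by (rule exE)
  then have S: "\<And>a. a \<in> V \<Longrightarrow> finite (S a)"
    "\<And>a. a \<in> V \<Longrightarrow> {b \<in> U_set leq. \<forall>i\<in>S a. \<forall>j\<in>S a. b (i, j) = a (i, j)} \<subseteq> V"
    by blast+
  \<comment> \<open>The union of full cylinders whose traces on \<open>U_set leq\<close> stay inside
    \<open>V\<close>.\<close>
  define W where "W = (\<Union>a\<in>V. {b. \<forall>i\<in>S a. \<forall>j\<in>S a. b (i, j) = a (i, j)})"
  have "openin mat_topology W"
    unfolding openin_mat_topology
  proof
    fix b assume "b \<in> W"
    then obtain a where a: "a \<in> V" "\<forall>i\<in>S a. \<forall>j\<in>S a. b (i, j) = a (i, j)"
      by (auto simp: W_def)
    then show "\<exists>T. finite T \<and> {c. \<forall>i\<in>T. \<forall>j\<in>T. c (i, j) = b (i, j)} \<subseteq> W"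
      using S(1)[of a] by (intro exI[of _ "S a"]) (auto simp: W_def)
  qed
  moreover have "V = W \<inter> U_set leq"
    using R S(2) by (auto simp: W_def)
  ultimately show "openin (U_topology leq) V"
    by (auto simp: U_topology_def openin_subtopology)
qed

text \<open>
  Basic neighbourhoods in \<open>AU_set leq\<close>: the entries with \<open>\<not> leq i j\<close>, finitely many of which
  are nonzero, are discrete coordinates, and the remaining ones carry the product topology.
\<close>

definition AU_nhd :: "('i \<Rightarrow> 'i \<Rightarrow> bool) \<Rightarrow> ('i, 'r::comm_ring_1) mat \<Rightarrow> 'i set \<Rightarrow> ('i, 'r) mat set" where
  "AU_nhd leq a S =
    {b \<in> AU_set leq. \<forall>i j. i \<in> S \<and> j \<in> S \<or> \<not> leq i j \<longrightarrow> b (i, j) = a (i, j)}"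

text \<open>An explicit candidate for the topology that \<open>AU_topology\<close> describes by its
  universal conditions.\<close>

definition AU_nhd_topology :: "('i \<Rightarrow> 'i \<Rightarrow> bool) \<Rightarrow> ('i, 'r::comm_ring_1) mat topology" where
  "AU_nhd_topology leq =
    topology (\<lambda>W. W \<subseteq> AU_set leq \<and> (\<forall>a\<in>W. \<exists>S. finite S \<and> AU_nhd leq a S \<subseteq> W))"

lemma AU_nhd_subset: "AU_nhd leq a S \<subseteq> AU_set leq"
  by (auto simp: AU_nhd_def)

lemma AU_nhd_mem: "a \<in> AU_set leq \<Longrightarrow> a \<in> AU_nhd leq a S"
  by (auto simp: AU_nhd_def)

lemma AU_nhd_mono: "S \<subseteq> T \<Longrightarrow> AU_nhd leq a T \<subseteq> AU_nhd leq a S"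
  by (auto simp: AU_nhd_def)

text \<open>Agreement on a fixed set of coordinates is an equivalence relation, so basic
  neighbourhoods are neighbourhoods of each of their points, hence open.\<close>

lemma AU_nhd_cong:
  assumes "b \<in> AU_nhd leq a S"
  shows "AU_nhd leq b S = AU_nhd leq a S"
proof -
  have "b (i, j) = a (i, j)" if "i \<in> S \<and> j \<in> S \<or> \<not> leq i j" for i j
    using assms that unfolding AU_nhd_def by blast
  then show ?thesis
    unfolding AU_nhd_def by (metis (no_types, lifting))
qed

lemma openin_AU_nhd_topology:
  fixes W :: "('i, 'r::comm_ring_1) mat set"
  shows "openin (AU_nhd_topology leq) W \<longleftrightarrow>
    W \<subseteq> AU_set leq \<and> (\<forall>a\<in>W. \<exists>S. finite S \<and> AU_nhd leq a S \<subseteq> W)"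
proof -
  define P where "P W \<longleftrightarrow> W \<subseteq> AU_set leq \<and> (\<forall>a\<in>W. \<exists>S. finite S \<and> AU_nhd leq a S \<subseteq> W)"
    for W :: "('i, 'r) mat set"
  have "P (W \<inter> W')" if W: "P W" and W': "P W'" for W W'
    unfolding P_def
  proof (intro conjI ballI)
    fix a assume "a \<in> W \<inter> W'"
    then obtain S S' where "finite S" "AU_nhd leq a S \<subseteq> W" "finite S'" "AU_nhd leq a S' \<subseteq> W'"
      using W W' unfolding P_def by blast
    then show "\<exists>S. finite S \<and> AU_nhd leq a S \<subseteq> W \<inter> W'"
      using AU_nhd_mono[of S "S \<union> S'" leq a] AU_nhd_mono[of S' "S \<union> S'" leq a]
      by (intro exI[of _ "S \<union> S'"]) auto
  qed (use W in \<open>auto simp: P_def\<close>)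
  moreover have "P (\<Union>K)" if "\<forall>W\<in>K. P W" for K
    using that unfolding P_def by (meson Sup_least UnionE Union_upper subset_trans)
  ultimately have "istopology P"
    unfolding istopology_def by blast
  then have "openin (topology P) = P"
    by (rule topology_inverse')
  moreover have "AU_nhd_topology leq = topology P"
    by (simp add: AU_nhd_topology_def P_def[abs_def])
  ultimately show ?thesis
    by (simp add: P_def)
qed

lemma topspace_AU_nhd_topology [simp]: "topspace (AU_nhd_topology leq) = AU_set leq"
proof -
  have "openin (AU_nhd_topology leq) (AU_set leq)"
    unfolding openin_AU_nhd_topology using AU_nhd_subset by blast
  then show ?thesis
    by (meson openin_AU_nhd_topology openin_subset openin_topspace subset_antisym)
qed

lemma openin_AU_nhd:
  assumes "finite S"
  shows "openin (AU_nhd_topology leq) (AU_nhd leq a S)"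
  unfolding openin_AU_nhd_topology
proof (intro conjI ballI)
  fix b assume "b \<in> AU_nhd leq a S"
  then show "\<exists>S'. finite S' \<and> AU_nhd leq b S' \<subseteq> AU_nhd leq a S"
    using assms AU_nhd_cong by blast
qed (rule AU_nhd_subset)

section \<open>Continuity of the group operations and identification of the topology\<close>

context Z_like_preorder
begin

text \<open>Entries with \<open>\<not> leq i j\<close> are frozen in a neighbourhood, so the zeros
  required by leq + T persist.\<close>

lemma AU_nhd_U_set:
  assumes "finite T" "a \<in> U_set (pre_collapse leq T)" "b \<in> AU_nhd leq a S"
  shows "b \<in> U_set (pre_collapse leq T)"
proof -
  have "upper_triangular (pre_collapse leq T) b"
    unfolding upper_triangular_def
  proof (intro allI impI)
    fix i j assume ij: "\<not> pre_collapse leq T i j"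
    then have "\<not> leq i j" by (simp add: pre_collapse_iff)
    then have "b (i, j) = a (i, j)" using assms(3) by (simp add: AU_nhd_def)
    then show "b (i, j) = 0" using assms(2) ij by (simp add: U_set_def upper_triangular_def)
  qed
  then show ?thesis
    using assms(1,3) AU_nhd_subset by (auto simp: U_set_pre_collapse_iff)
qed

text \<open>Inside U(leq + T) each discrete coordinate lies in \<open>T \<times> T\<close> or is
  zero, so agreement on the finite block already controls all of them.\<close>

lemma AU_nhd_pre_collapseI:
  assumes T: "finite T" "strongly_convex leq T" and "S \<subseteq> T"
    and a: "a \<in> U_set (pre_collapse leq T)" and b: "b \<in> U_set (pre_collapse leq T)"
    and eq: "\<And>i j. i \<in> T \<Longrightarrow> j \<in> T \<Longrightarrow> b (i, j) = a (i, j)"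
  shows "b \<in> AU_nhd leq a S"
proof -
  have "b (i, j) = a (i, j)" if "\<not> leq i j" for i j
  proof (cases "pre_collapse leq T i j")
    case True
    then show ?thesis using pre_collapse_mem[OF T(2) subset_refl True that] eq by blast
  next
    case False
    then show ?thesis using a b by (simp add: U_set_def upper_triangular_def)
  qed
  then show ?thesis
    using b eq \<open>S \<subseteq> T\<close> T(1) unfolding AU_nhd_def U_set_pre_collapse_iff[OF T(1)] by blast
qed

text \<open>Continuity of multiplication: in U(leq + T) the block of a product on \<open>T\<close>
  depends only on the blocks of the factors on \<open>T\<close>.\<close>

lemma mat_mult_AU_nhd:
  fixes a b :: "('i, 'k::{field, finite}) mat"
  assumes "a \<in> AU_set leq" "b \<in> AU_set leq" "finite S"
  obtains T where "finite T"
    "\<And>a' b'. a' \<in> AU_nhd leq a T \<Longrightarrow> b' \<in> AU_nhd leq b T \<Longrightarrow>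
      mat_mult a' b' \<in> AU_nhd leq (mat_mult a b) S"
proof -
  obtain T where T: "S \<subseteq> T" "finite T" "strongly_convex leq T"
    and ab: "{a, b} \<subseteq> U_set (pre_collapse leq T)"
    by (rule AU_set_hull[of "{a, b}" S]) (use assms in auto)
  interpret T: Z_like_preorder "pre_collapse leq T"
    by (rule Z_like_preorder_pre_collapse) fact
  have convex: "pre_convex (pre_collapse leq T) T"
    using strongly_convex_pre_collapse[OF T(3)] strongly_convex_imp_pre_convex by blast
  have "mat_mult a' b' \<in> AU_nhd leq (mat_mult a b) S"
    if a': "a' \<in> AU_nhd leq a T" and b': "b' \<in> AU_nhd leq b T" for a' b'
  proof (rule AU_nhd_pre_collapseI[OF T(2,3,1)])
    have U: "a' \<in> U_set (pre_collapse leq T)" "b' \<in> U_set (pre_collapse leq T)"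
      using AU_nhd_U_set[OF T(2)] ab a' b' by blast+
    then show "mat_mult a' b' \<in> U_set (pre_collapse leq T)" "mat_mult a b \<in> U_set (pre_collapse leq T)"
      using ab by (auto intro: T.mat_mult_in_U_set)
    have ut: "upper_triangular (pre_collapse leq T) c" if "c \<in> {a, b, a', b'}" for c
      using that ab U by (auto simp: U_set_def)
    show "mat_mult a' b' (i, j) = mat_mult a b (i, j)" if "i \<in> T" "j \<in> T" for i j
      using that a' b' mat_mult_eq_sum[OF ut[of a'] ut[of b'] T(2) convex that]
        mat_mult_eq_sum[OF ut[of a] ut[of b] T(2) convex that]
      by (simp add: AU_nhd_def)
  qed
  with T(2) show thesis by (rule that)
qed

text \<open>Continuity of inversion: the block of the inverse on \<open>T\<close> is the inverse of
  the block, so it is determined by that block.\<close>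

lemma inv_AU_nhd:
  fixes a :: "('i, 'k::{field, finite}) mat"
  assumes "a \<in> AU_set leq" "finite S"
  obtains T where "finite T"
    "\<And>b. b \<in> AU_nhd leq a T \<Longrightarrow> inv\<^bsub>AU leq\<^esub> b \<in> AU_nhd leq (inv\<^bsub>AU leq\<^esub> a) S"
proof -
  obtain T where T: "S \<subseteq> T" "finite T" "strongly_convex leq T"
    and a: "a \<in> U_set (pre_collapse leq T)"
    by (rule AU_set_hull[of "{a}" S]) (use assms in auto)
  interpret T: Z_like_preorder "pre_collapse leq T"
    by (rule Z_like_preorder_pre_collapse) fact
  have convex: "pre_convex (pre_collapse leq T) T"
    using strongly_convex_pre_collapse[OF T(3)] strongly_convex_imp_pre_convex by blast
  have block: "block_inverse T c (inv\<^bsub>AU leq\<^esub> c)" if "c \<in> U_set (pre_collapse leq T)" for c :: "('i, 'k) mat"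
    using inv_AU[OF T(2) that] that T(2) convex
    by (intro T.block_inverseI) (auto simp: U_set_def)
  have "inv\<^bsub>AU leq\<^esub> b \<in> AU_nhd leq (inv\<^bsub>AU leq\<^esub> a) S" if b: "b \<in> AU_nhd leq a T" for b
  proof (rule AU_nhd_pre_collapseI[OF T(2,3,1)])
    have U: "b \<in> U_set (pre_collapse leq T)"
      using AU_nhd_U_set[OF T(2) a b] .
    show "inv\<^bsub>AU leq\<^esub> a \<in> U_set (pre_collapse leq T)" "inv\<^bsub>AU leq\<^esub> b \<in> U_set (pre_collapse leq T)"
      using inv_AU(1)[OF T(2)] a U by blast+
    have eq: "b (i, j) = a (i, j)" if "i \<in> T" "j \<in> T" for i j
      using b that by (simp add: AU_nhd_def)
    then have "block_inverse T a (inv\<^bsub>AU leq\<^esub> b)"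
      using block[OF U] by (simp add: block_inverse_def)
    then show "(inv\<^bsub>AU leq\<^esub> b) (i, j) = (inv\<^bsub>AU leq\<^esub> a) (i, j)" if "i \<in> T" "j \<in> T" for i j
      using block_inverse_unique block[OF a] T(2) that by metis
  qed
  with T(2) show thesis by (rule that)
qed

lemma group_topology_AU_nhd_topology:
  "group_topology (AU leq :: ('i, 'k::{field, finite}) mat monoid) (AU_nhd_topology leq)"
proof -
  interpret G: group "AU leq :: ('i, 'k) mat monoid" by (rule group_AU)
  let ?T = "AU_nhd_topology leq :: ('i, 'k) mat topology"
  have carrier: "carrier (AU leq) = AU_set leq" and mult: "x \<otimes>\<^bsub>AU leq\<^esub> y = mat_mult x y"
    for x y :: "('i, 'k) mat"
    by (simp_all add: AU_def)
  have "continuous_map (prod_topology ?T ?T) ?T (\<lambda>(x, y). mat_mult x y)"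
    unfolding continuous_map_def
  proof (intro conjI allI impI)
    show "(\<lambda>(x, y). mat_mult x y) \<in> topspace (prod_topology ?T ?T) \<rightarrow> topspace ?T"
      using G.m_closed by (auto simp: carrier mult)
    fix W :: "('i, 'k) mat set" assume W: "openin ?T W"
    show "openin (prod_topology ?T ?T)
        {p \<in> topspace (prod_topology ?T ?T). (case p of (x, y) \<Rightarrow> mat_mult x y) \<in> W}"
      unfolding openin_prod_topology_alt
    proof (intro allI impI)
      fix a b :: "('i, 'k) mat"
      assume "(a, b) \<in> {p \<in> topspace (prod_topology ?T ?T). (case p of (x, y) \<Rightarrow> mat_mult x y) \<in> W}"
      then have ab: "a \<in> AU_set leq" "b \<in> AU_set leq" "mat_mult a b \<in> W" by auto
      then obtain S where S: "finite S" "AU_nhd leq (mat_mult a b) S \<subseteq> W"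
        using W by (auto simp: openin_AU_nhd_topology)
      obtain T where T: "finite T"
        "\<And>a' b'. a' \<in> AU_nhd leq a T \<Longrightarrow> b' \<in> AU_nhd leq b T \<Longrightarrow>
          mat_mult a' b' \<in> AU_nhd leq (mat_mult a b) S"
        using mat_mult_AU_nhd[OF ab(1,2) S(1)] by metis
      have "AU_nhd leq a T \<times> AU_nhd leq b T \<subseteq>
          {p \<in> topspace (prod_topology ?T ?T). (case p of (x, y) \<Rightarrow> mat_mult x y) \<in> W}"
        using T(2) S(2) AU_nhd_subset[of leq a T] AU_nhd_subset[of leq b T] by auto
      then show "\<exists>U V. openin ?T U \<and> openin ?T V \<and> a \<in> U \<and> b \<in> V \<and> U \<times> V \<subseteq>
          {p \<in> topspace (prod_topology ?T ?T). (case p of (x, y) \<Rightarrow> mat_mult x y) \<in> W}"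
        using openin_AU_nhd[OF T(1)] AU_nhd_mem[OF ab(1)] AU_nhd_mem[OF ab(2)]
        by (intro exI[of _ "AU_nhd leq a T"] exI[of _ "AU_nhd leq b T"] conjI)
    qed
  qed
  moreover have "continuous_map ?T ?T (\<lambda>x. inv\<^bsub>AU leq\<^esub> x)"
    unfolding continuous_map_def
  proof (intro conjI allI impI)
    show "(\<lambda>x. inv\<^bsub>AU leq\<^esub> x) \<in> topspace ?T \<rightarrow> topspace ?T"
      using G.inv_closed by (auto simp: carrier)
    fix W :: "('i, 'k) mat set" assume W: "openin ?T W"
    show "openin ?T {x \<in> topspace ?T. inv\<^bsub>AU leq\<^esub> x \<in> W}"
      unfolding openin_AU_nhd_topology
    proof (intro conjI ballI)
      fix a assume "a \<in> {x \<in> topspace ?T. inv\<^bsub>AU leq\<^esub> x \<in> W}"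
      then have a: "a \<in> AU_set leq" "inv\<^bsub>AU leq\<^esub> a \<in> W" by auto
      then obtain S where S: "finite S" "AU_nhd leq (inv\<^bsub>AU leq\<^esub> a) S \<subseteq> W"
        using W by (auto simp: openin_AU_nhd_topology)
      obtain T where T: "finite T"
        "\<And>b. b \<in> AU_nhd leq a T \<Longrightarrow> inv\<^bsub>AU leq\<^esub> b \<in> AU_nhd leq (inv\<^bsub>AU leq\<^esub> a) S"
        using inv_AU_nhd[OF a(1) S(1)] by metis
      then have "AU_nhd leq a T \<subseteq> {x \<in> topspace ?T. inv\<^bsub>AU leq\<^esub> x \<in> W}"
        using S(2) AU_nhd_subset[of leq a T] by auto
      with T(1) show "\<exists>T. finite T \<and> AU_nhd leq a T \<subseteq> {x \<in> topspace ?T. inv\<^bsub>AU leq\<^esub> x \<in> W}"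
        by blast
    qed auto
  qed
  ultimately show ?thesis
    by (simp add: group_topology_def carrier mult G.group_axioms)
qed

lemma continuous_map_U_topology_AU_nhd_topology:
  assumes "finite S"
  shows "continuous_map (U_topology (pre_collapse leq S) :: ('i, 'r::comm_ring_1) mat topology)
    (AU_nhd_topology leq) (\<lambda>a. a)"
  unfolding continuous_map_def
proof (intro conjI allI impI)
  show "(\<lambda>a. a) \<in> topspace (U_topology (pre_collapse leq S)) \<rightarrow> topspace (AU_nhd_topology leq)"
    using assms by (auto simp: U_set_pre_collapse_iff)
  fix W :: "('i, 'r) mat set" assume W: "openin (AU_nhd_topology leq) W"
  show "openin (U_topology (pre_collapse leq S))
      {a \<in> topspace (U_topology (pre_collapse leq S)). a \<in> W}"
    unfolding openin_U_topology
  proof (intro conjI ballI)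
    fix a assume "a \<in> {a \<in> topspace (U_topology (pre_collapse leq S)). a \<in> W}"
    then have a: "a \<in> U_set (pre_collapse leq S)" "a \<in> W" by auto
    then obtain F where F: "finite F" "AU_nhd leq a F \<subseteq> W"
      using W by (auto simp: openin_AU_nhd_topology)
    \<comment> \<open>Containing \<open>S\<close> puts U(leq + S) inside U(leq + T); containing
      \<open>F\<close> makes agreement on \<open>T\<close> sufficient for membership in
      \<open>AU_nhd leq a F\<close>.\<close>
    obtain T where T: "F \<union> S \<subseteq> T" "finite T" "strongly_convex leq T"
      by (rule strongly_convex_hull[of "F \<union> S"]) (use F assms in auto)
    have "b \<in> W"
      if b: "b \<in> U_set (pre_collapse leq S)" "\<forall>i\<in>T. \<forall>j\<in>T. b (i, j) = a (i, j)" for b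
    proof -
      have "c \<in> U_set (pre_collapse leq T)" if "c \<in> U_set (pre_collapse leq S)" for c :: "('i, 'r) mat"
      proof -
        have "upper_triangular (pre_collapse leq T) c"
          unfolding upper_triangular_def
        proof (intro allI impI)
          fix i j assume "\<not> pre_collapse leq T i j"
          then have "\<not> pre_collapse leq S i j" using T(1) unfolding pre_collapse_iff by blast
          then show "c (i, j) = 0" using that by (simp add: U_set_def upper_triangular_def)
        qed
        with that T(2) assms show ?thesis by (simp add: U_set_pre_collapse_iff)
      qed
      then have "b \<in> AU_nhd leq a F"
        using T a b by (intro AU_nhd_pre_collapseI[OF T(2,3)]) auto
      then show ?thesis using F by blast
    qed
    then show "\<exists>T. finite T \<and> {b \<in> U_set (pre_collapse leq S). \<forall>i\<in>T. \<forall>j\<in>T. b (i, j) = a (i, j)}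
        \<subseteq> {a \<in> topspace (U_topology (pre_collapse leq S)). a \<in> W}"
      using T(2) by (intro exI[of _ T]) auto
  qed auto
qed

text \<open>Every basic neighbourhood of a point of U(leq + S) stays inside U(leq + S).\<close>

lemma open_map_U_topology_AU_nhd_topology:
  assumes "finite S"
  shows "open_map (U_topology (pre_collapse leq S) :: ('i, 'r::comm_ring_1) mat topology)
    (AU_nhd_topology leq) (\<lambda>a. a)"
  unfolding open_map_def
proof (intro allI impI)
  fix V :: "('i, 'r) mat set" assume V: "openin (U_topology (pre_collapse leq S)) V"
  then have sub: "V \<subseteq> U_set (pre_collapse leq S)"
    by (simp add: openin_U_topology)
  show "openin (AU_nhd_topology leq) ((\<lambda>a. a) ` V)"
    unfolding openin_AU_nhd_topology
  proof (intro conjI ballI)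
    show "(\<lambda>a. a) ` V \<subseteq> AU_set leq"
      using sub assms by (auto simp: U_set_pre_collapse_iff)
    fix a assume "a \<in> (\<lambda>a. a) ` V"
    then have a: "a \<in> V" by simp
    then obtain F where F: "finite F"
      "{b \<in> U_set (pre_collapse leq S). \<forall>i\<in>F. \<forall>j\<in>F. b (i, j) = a (i, j)} \<subseteq> V"
      using V by (auto simp: openin_U_topology)
    have "AU_nhd leq a F \<subseteq> V"
    proof
      fix b assume b: "b \<in> AU_nhd leq a F"
      then have "b \<in> U_set (pre_collapse leq S)"
        using AU_nhd_U_set assms sub a by blast
      then show "b \<in> V" using F(2) b by (auto simp: AU_nhd_def)
    qed
    with F(1) show "\<exists>F. finite F \<and> AU_nhd leq a F \<subseteq> (\<lambda>a. a) ` V" by auto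
  qed
qed

lemma AU_topology_eq:
  "(AU_topology leq :: ('i, 'k::{field, finite}) mat topology) = AU_nhd_topology leq"
  unfolding AU_topology_def
proof (rule the_equality, intro conjI allI impI)
  let ?A = "AU_nhd_topology leq :: ('i, 'k) mat topology"
  show "group_topology (AU leq) ?A"
    by (rule group_topology_AU_nhd_topology)
  show cont: "continuous_map (U_topology (pre_collapse leq S)) ?A (\<lambda>a. a)"
    if "finite S \<and> pre_convex leq S" for S
    using that continuous_map_U_topology_AU_nhd_topology by blast
  show opn: "open_map (U_topology (pre_collapse leq S)) ?A (\<lambda>a. a)"
    if "finite S \<and> pre_convex leq S" for S
    using that open_map_U_topology_AU_nhd_topology by blast
  \<comment> \<open>Uniqueness: the trace of a \<open>T\<close>-open set on each U(leq + S) is open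
    there by continuity into \<open>T\<close>, and open in \<open>T'\<close> by openness; these
    traces cover the set. Both inclusions between the two topologies follow.\<close>
  have openin_mono: "openin T' W"
    if top: "topspace T = AU_set leq" and W: "openin T W"
      and cont: "\<And>S. finite S \<and> pre_convex leq S \<Longrightarrow>
        continuous_map (U_topology (pre_collapse leq S)) T (\<lambda>a. a)"
      and opn: "\<And>S. finite S \<and> pre_convex leq S \<Longrightarrow>
        open_map (U_topology (pre_collapse leq S)) T' (\<lambda>a. a)"
    for T T' :: "('i, 'k) mat topology" and W
  proof (subst openin_subopen, intro ballI)
    fix a assume a: "a \<in> W"
    then have "a \<in> AU_set leq" using openin_subset[OF W] top by blast
    then obtain S where S: "finite S" "strongly_convex leq S" "a \<in> U_set (pre_collapse leq S)"
      by (auto intro: AU_set_hull[of "{a}" "{}"])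
    let ?V = "{a \<in> topspace (U_topology (pre_collapse leq S)). a \<in> W}"
    have S': "finite S \<and> pre_convex leq S"
      using S strongly_convex_imp_pre_convex by blast
    have "openin (U_topology (pre_collapse leq S)) ?V"
      using cont[OF S'] W unfolding continuous_map_def by blast
    then have "openin T' ((\<lambda>a. a) ` ?V)"
      using opn[OF S'] unfolding open_map_def by blast
    then show "\<exists>V. openin T' V \<and> a \<in> V \<and> V \<subseteq> W"
      using a S(3) by (intro exI[of _ ?V]) auto
  qed
  fix T :: "('i, 'k) mat topology"
  assume T: "group_topology (AU leq) T \<and> (\<forall>S. finite S \<and> pre_convex leq S \<longrightarrow>
    continuous_map (U_topology (pre_collapse leq S)) T (\<lambda>a. a) \<and>
    open_map (U_topology (pre_collapse leq S)) T (\<lambda>a. a))"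
  then have top: "topspace T = AU_set leq"
    by (simp add: group_topology_def AU_def)
  show "T = ?A"
    unfolding topology_eq
  proof (intro allI iffI)
    show "openin ?A W" if "openin T W" for W
      using openin_mono[OF top that] T opn by blast
    show "openin T W" if "openin ?A W" for W
      using openin_mono[of ?A W T] that T cont by auto
  qed
qed

end

section \<open>Scalar matrices and transvections\<close>

definition scalar :: "'r::comm_ring_1 \<Rightarrow> ('i, 'r) mat" where
  "scalar c = (\<lambda>(i, j). if i = j then c else 0)"

lemma mat_mult_scalar_left: "mat_mult (scalar c) a = (\<lambda>p. c * a p)"
proof (rule ext, clarify)
  fix i j
  have "mat_mult (scalar c) a (i, j) = (\<Sum>k\<in>{i}. scalar c (i, k) * a (k, j))"
    unfolding mat_mult_def by (simp only: prod.case, rule Sum_any.expand_superset) (auto simp: scalar_def)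
  then show "mat_mult (scalar c) a (i, j) = c * a (i, j)"
    by (simp add: scalar_def)
qed

lemma mat_mult_scalar_right: "mat_mult a (scalar c) = (\<lambda>p. c * a p)"
proof (rule ext, clarify)
  fix i j
  have "mat_mult a (scalar c) (i, j) = (\<Sum>k\<in>{j}. a (i, k) * scalar c (k, j))"
    unfolding mat_mult_def
    by (simp only: prod.case, rule Sum_any.expand_superset) (auto simp: scalar_def split: if_splits)
  then show "mat_mult a (scalar c) (i, j) = c * a (i, j)"
    by (simp add: scalar_def mult.commute)
qed

lemma scalar_mat_iff: "scalar_mat a \<longleftrightarrow> (\<exists>c. a = scalar c)"
proof
  assume "scalar_mat a"
  then obtain c where "\<And>i. a (i, i) = c" "\<And>i j. i \<noteq> j \<Longrightarrow> a (i, j) = 0"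
    by (auto simp: scalar_mat_def)
  then have "a = scalar c"
    by (auto simp: fun_eq_iff scalar_def)
  then show "\<exists>c. a = scalar c" ..
qed (auto simp: scalar_mat_def scalar_def)

definition transvection :: "'i \<Rightarrow> 'i \<Rightarrow> 'r::comm_ring_1 \<Rightarrow> ('i, 'r) mat" where
  "transvection i j c = (\<lambda>p. mat_one p + (if p = (i, j) then c else 0))"

lemma mat_mult_transvection_right:
  assumes "i \<noteq> j"
  shows "mat_mult a (transvection i j c) (k, l) = a (k, l) + (if l = j then a (k, i) * c else 0)"
proof -
  \<comment> \<open>Column \<open>l\<close> of a transvection is zero outside rows \<open>l\<close>
    and \<open>i\<close>, so the sum is finite for arbitrary \<open>a\<close>.\<close>
  have "mat_mult a (transvection i j c) (k, l) = (\<Sum>m\<in>{l, i}. a (k, m) * transvection i j c (m, l))"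
    unfolding mat_mult_def
    by (simp only: prod.case, rule Sum_any.expand_superset)
      (auto simp: transvection_def mat_one_def split: if_splits)
  then show ?thesis
    using assms by (cases "l = i") (auto simp: transvection_def mat_one_def)
qed

lemma mat_mult_transvection_left:
  assumes "i \<noteq> j"
  shows "mat_mult (transvection i j c) a (k, l) = a (k, l) + (if k = i then c * a (j, l) else 0)"
proof -
  have "mat_mult (transvection i j c) a (k, l) = (\<Sum>m\<in>{k, j}. transvection i j c (k, m) * a (m, l))"
    unfolding mat_mult_def
    by (simp only: prod.case, rule Sum_any.expand_superset)
      (auto simp: transvection_def mat_one_def split: if_splits)
  then show ?thesis
    using assms by (cases "k = j") (auto simp: transvection_def mat_one_def)
qed

context Z_like_preorder
begin

lemma transvection_in_U_set:
  assumes "leq i j" "i \<noteq> j"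
  shows "transvection i j c \<in> U_set leq"
proof -
  have "upper_triangular leq (transvection i j d)" for d :: 'a
    using assms(1) by (auto simp: upper_triangular_def transvection_def mat_one_def)
  moreover have "mat_mult (transvection i j d) (transvection i j (- d)) = mat_one" for d :: 'a
    using assms(2)
    by (auto simp: fun_eq_iff mat_mult_transvection_left) (auto simp: transvection_def mat_one_def)
  \<comment> \<open>The two instances make the transvection with \<open>- c\<close> a right and a
    left inverse.\<close>
  from this[of c] this[of "- c"]
  have "mat_mult (transvection i j c) (transvection i j (- c)) = mat_one"
    "mat_mult (transvection i j (- c)) (transvection i j c) = mat_one"
    by simp_all
  ultimately show ?thesis by (intro U_setI)
qed

lemma U_set_subset_AU_set: "U_set leq \<subseteq> AU_set leq"
proof
  fix a :: "('i, 'a) mat" assume a: "a \<in> U_set leq"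
  then have "{(i, j). \<not> leq i j \<and> a (i, j) \<noteq> 0} = {}"
    by (auto simp: U_set_def upper_triangular_def)
  then have "almost_upper_triangular leq a"
    unfolding almost_upper_triangular_def by (simp only: finite.emptyI)
  with a show "a \<in> AU_set leq" by (simp add: U_set_def AU_set_def)
qed

lemma scalar_in_U_set:
  fixes c :: "'k::field"
  assumes "c \<noteq> 0"
  shows "scalar c \<in> U_set leq"
proof (rule U_setI)
  show "upper_triangular leq (scalar c)" "upper_triangular leq (scalar (inverse c))"
    by (auto simp: upper_triangular_def scalar_def)
  show "mat_mult (scalar c) (scalar (inverse c)) = mat_one"
    "mat_mult (scalar (inverse c)) (scalar c) = mat_one"
    unfolding mat_mult_scalar_left using assms by (auto simp: scalar_def mat_one_def)
qed

text \<open>A nonsingular scalar matrix is upper triangular, hence has an inverse \<open>b\<close>,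
  and a diagonal entry of the product reads \<open>c * b (i, i) = 1\<close>.\<close>

lemma Z_set_eq: "(Z_set leq :: ('i, 'k::{field, finite}) mat set) = {scalar c |c. c \<noteq> 0}"
proof (intro equalityI subsetI)
  fix z :: "('i, 'k) mat" assume z: "z \<in> Z_set leq"
  then obtain c where c: "z = scalar c" by (auto simp: Z_set_def scalar_mat_iff)
  have "z \<in> U_set leq"
    using z unfolding c by (auto simp: Z_set_def U_set_def upper_triangular_def scalar_def)
  then obtain b where "mat_mult z b = mat_one" by (rule U_set_inverse)
  then have "c * b (i, i) = 1" for i
    unfolding c mat_mult_scalar_left by (auto simp: fun_eq_iff mat_one_def split: if_splits)
  then have "c \<noteq> 0" by (metis mult_zero_left zero_neq_one)
  with c show "z \<in> {scalar c |c. c \<noteq> 0}" by blast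
next
  fix z :: "('i, 'k) mat" assume "z \<in> {scalar c |c. c \<noteq> 0}"
  then obtain c where c: "z = scalar c" "c \<noteq> 0" by blast
  then have "z \<in> U_set leq"
    by (simp add: scalar_in_U_set)
  then show "z \<in> Z_set leq"
    using c by (auto simp: Z_set_def U_set_def scalar_mat_iff)
qed

lemma normal_Z_set: "Z_set leq \<lhd> (AU leq :: ('i, 'k::{field, finite}) mat monoid)"
proof -
  interpret G: group "AU leq :: ('i, 'k) mat monoid" by (rule group_AU)
  have carrier: "carrier (AU leq) = AU_set leq" and mult: "x \<otimes>\<^bsub>AU leq\<^esub> y = mat_mult x y"
    and one: "\<one>\<^bsub>AU leq\<^esub> = (scalar 1 :: ('i, 'k) mat)"
    for x y :: "('i, 'k) mat"
    by (auto simp: AU_def scalar_def mat_one_def)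
  have scalar: "scalar c \<in> AU_set leq" if "c \<noteq> 0" for c :: 'k
    using scalar_in_U_set[OF that] U_set_subset_AU_set by blast
  have Z: "scalar c \<in> Z_set leq" if "c \<noteq> 0" for c :: 'k
    unfolding Z_set_eq using that by blast
  have ZE: "\<exists>c. a = scalar c \<and> c \<noteq> 0" if "a \<in> Z_set leq" for a :: "('i, 'k) mat"
    using that unfolding Z_set_eq by blast
  have inv: "inv\<^bsub>AU leq\<^esub> (scalar c) = scalar (inverse c)" if "c \<noteq> 0" for c :: 'k
  proof (rule G.inv_equality)
    show "scalar (inverse c) \<otimes>\<^bsub>AU leq\<^esub> scalar c = \<one>\<^bsub>AU leq\<^esub>"
      unfolding mult one mat_mult_scalar_left using that by (auto simp: scalar_def)
  qed (use that scalar in \<open>simp_all add: carrier\<close>)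
  have "subgroup (Z_set leq) (AU leq :: ('i, 'k) mat monoid)"
  proof (rule G.subgroupI)
    show "Z_set leq \<subseteq> carrier (AU leq :: ('i, 'k) mat monoid)"
      unfolding carrier Z_set_eq using scalar by auto
    show "Z_set leq \<noteq> ({} :: ('i, 'k) mat set)"
      using Z[OF one_neq_zero] by (metis empty_iff)
    show "inv\<^bsub>AU leq\<^esub> a \<in> Z_set leq" if a: "a \<in> Z_set leq" for a :: "('i, 'k) mat"
    proof -
      obtain c where "a = scalar c" "c \<noteq> 0" using ZE[OF a] by blast
      then show ?thesis using inv Z[of "inverse c"] by simp
    qed
    show "a \<otimes>\<^bsub>AU leq\<^esub> b \<in> Z_set leq" if ab: "a \<in> Z_set leq" "b \<in> Z_set leq" for a b :: "('i, 'k) mat"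
    proof -
      obtain c d where "a = scalar c" "b = scalar d" "c \<noteq> 0" "d \<noteq> 0"
        using ZE ab by blast
      then have cd: "c * d \<noteq> 0" "a \<otimes>\<^bsub>AU leq\<^esub> b = scalar (c * d)"
        unfolding mult by (auto simp: mat_mult_scalar_left) (auto simp: scalar_def)
      show ?thesis unfolding cd(2) using cd(1) by (rule Z)
    qed
  qed
  moreover have "x \<otimes>\<^bsub>AU leq\<^esub> h \<otimes>\<^bsub>AU leq\<^esub> inv\<^bsub>AU leq\<^esub> x \<in> Z_set leq"
    if x: "x \<in> carrier (AU leq)" and h: "h \<in> Z_set leq" for x h :: "('i, 'k) mat"
  proof -
    \<comment> \<open>Scalars are central, so conjugation fixes them.\<close>
    have "x \<otimes>\<^bsub>AU leq\<^esub> h = h \<otimes>\<^bsub>AU leq\<^esub> x"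
      using ZE[OF h] by (auto simp: mult mat_mult_scalar_left mat_mult_scalar_right)
    moreover have "h \<in> carrier (AU leq)" using ZE[OF h] scalar carrier by auto
    ultimately show ?thesis using x h by (simp add: G.m_assoc)
  qed
  ultimately show ?thesis by (rule G.normal_invI)
qed

section \<open>Matrices commuting with transvections up to a scalar\<close>

text \<open>
  If \<open>x\<close> commutes with the transvection \<open>1 + e\<^sub>i\<^sub>j\<close> up to a scalar \<open>c\<close>, then \<open>c = 1\<close>: otherwise \<open>x\<close>
  is supported on row \<open>i\<close> and column \<open>j\<close>, which forces two other rows to be proportional.
\<close>

lemma commute_transvection:
  fixes x :: "('i, 'k::{field, finite}) mat"
  assumes inf: "infinite (UNIV :: 'i set)" and x: "x \<in> AU_set leq" and ij: "i \<noteq> j"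
    and comm: "mat_mult x (transvection i j 1) = (\<lambda>p. c * mat_mult (transvection i j 1) x p)"
  shows "k \<noteq> i \<Longrightarrow> x (k, i) = 0" "l \<noteq> j \<Longrightarrow> x (j, l) = 0" "x (i, i) = x (j, j)"
proof -
  have eq: "x (k, l) + (if l = j then x (k, i) else 0) = c * (x (k, l) + (if k = i then x (j, l) else 0))"
    for k l
    using fun_cong[OF comm, of "(k, l)"]
    by (simp add: mat_mult_transvection_left[OF ij] mat_mult_transvection_right[OF ij] cong: if_cong)
  have "c = 1"
  proof (rule ccontr)
    assume "c \<noteq> 1"
    then have zero: "x (k, l) = 0" if "k \<noteq> i" "l \<noteq> j" for k l
      using eq[of k l] that by simp
    interpret G: group "AU leq :: ('i, 'k) mat monoid" by (rule group_AU)
    obtain b where "mat_mult x b = mat_one"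
      using G.r_inv[of x] x by (auto simp: AU_def)
    moreover have "mat_mult x b (k, m) = x (k, j) * b (j, m)" if "k \<noteq> i" for k m
    proof -
      have "mat_mult x b (k, m) = (\<Sum>l\<in>{j}. x (k, l) * b (l, m))"
        unfolding mat_mult_def
        by (simp only: prod.case, rule Sum_any.expand_superset) (use zero that in auto)
      then show ?thesis by simp
    qed
    ultimately have b: "x (k, j) * b (j, m) = mat_one (k, m)" if "k \<noteq> i" for k m
      using that by metis
    obtain k where k: "k \<noteq> i"
      using ex_new_if_finite[OF inf, of "{i}"] by auto
    obtain m where m: "m \<noteq> i" "m \<noteq> k"
      using ex_new_if_finite[OF inf, of "{i, k}"] by auto
    \<comment> \<open>The entries (k, k) and (k, m) of the product give
      \<open>x (k, j) \<noteq> 0\<close> and hence \<open>b (j, m) = 0\<close>, contradicting the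
      entry (m, m).\<close>
    show False
      using b[OF k, of k] b[OF k, of m] b[OF m(1), of m] m(2) by (auto simp: mat_one_def)
  qed
  with eq have eq: "(if l = j then x (k, i) else 0) = (if k = i then x (j, l) else 0)" for k l
    by (simp cong: if_cong)
  \<comment> \<open>Column \<open>j\<close> of the remaining equation gives the first claim, row
    \<open>i\<close> the second, and the entry (i, j) the third.\<close>
  show "k \<noteq> i \<Longrightarrow> x (k, i) = 0" "l \<noteq> j \<Longrightarrow> x (j, l) = 0" "x (i, i) = x (j, j)"
    using eq[of j k] eq[of l i] eq[of j i] ij by auto
qed

lemma scalar_if_locally_central:
  fixes x :: "('i, 'k::{field, finite}) mat"
  assumes inf: "infinite (UNIV :: 'i set)" and x: "x \<in> AU_set leq" and S: "finite S"
    and comm: "\<And>y. y \<in> AU_nhd leq mat_one S \<Longrightarrow> \<exists>c. mat_mult x y = (\<lambda>p. c * mat_mult y x p)"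
  shows "x \<in> Z_set leq"
proof -
  have tv: "(\<forall>k. k \<noteq> i \<longrightarrow> x (k, i) = 0) \<and> (\<forall>l. l \<noteq> j \<longrightarrow> x (j, l) = 0) \<and> x (i, i) = x (j, j)"
    if ij: "leq i j" "i \<noteq> j" "\<not> (i \<in> S \<and> j \<in> S)" for i j
  proof -
    have "transvection i j 1 \<in> AU_set leq"
      using transvection_in_U_set[OF ij(1,2)] U_set_subset_AU_set by blast
    \<comment> \<open>The only off-diagonal entry sits at (i, j), which is outside
      \<open>S \<times> S\<close> and not among the discrete coordinates, as
      \<open>leq i j\<close>.\<close>
    then have "transvection i j 1 \<in> AU_nhd leq mat_one S"
      using ij by (auto simp: AU_nhd_def transvection_def)
    then obtain c where "mat_mult x (transvection i j 1) = (\<lambda>p. c * mat_mult (transvection i j 1) x p)"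
      using comm by blast
    from commute_transvection[OF inf x ij(2) this] show ?thesis by blast
  qed
  have "(k \<noteq> l \<longrightarrow> x (k, l) = 0) \<and> x (k, k) = x (l, l)" for k l
  proof -
    obtain T where T: "S \<union> {k, l} \<subseteq> T" "finite T" "strongly_convex leq T"
      by (rule strongly_convex_hull[of "S \<union> {k, l}"]) (use S in auto)
    obtain m where m: "m \<notin> T"
      using ex_new_if_finite[OF inf T(2)] by blast
    then have neq: "m \<noteq> k" "m \<noteq> l" "m \<notin> S" using T(1) by auto
    from T(3) m show ?thesis
    proof (cases rule: strongly_convexE)
      \<comment> \<open>The pair (m, k) clears row \<open>k\<close> off the diagonal; the two pairs
        equate both diagonal entries with \<open>x (m, m)\<close>.\<close>
      case below
      then have "leq m k" "leq m l" using T(1) by auto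
      then show ?thesis using tv[of m k] tv[of m l] neq by metis
    next
      \<comment> \<open>Here the pair (l, m) clears column \<open>l\<close> off the
        diagonal.\<close>
      case above
      then have "leq k m" "leq l m" using T(1) by auto
      then show ?thesis using tv[of k m] tv[of l m] neq by metis
    qed
  qed
  then have "scalar_mat x"
    unfolding scalar_mat_def by blast
  then show ?thesis
    using x by (simp add: Z_set_def AU_set_def)
qed

end

section \<open>The quasi-centre of the quotient by the scalars\<close>

theorem corollary6p4:
  fixes q :: nat
    and leq :: "'i \<Rightarrow> 'i \<Rightarrow> bool"
  assumes "primepow q"
    and "CARD('k::{field, finite}) = q"
    and "infinite (UNIV :: 'i set)"
    and "is_preorder leq"
    and "Z_like leq"
  shows "quasi_centre
           ((AU leq :: ('i, 'k) mat monoid) Mod Z_set leq)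
           (quotient_group_topology (AU leq) (Z_set leq) (AU_topology leq)) =
         {\<one>\<^bsub>(AU leq :: ('i, 'k) mat monoid) Mod Z_set leq\<^esub>}"
proof -
  interpret Z_like_preorder leq using assms(4,5) by unfold_locales
  let ?G = "AU leq :: ('i, 'k) mat monoid"
  let ?Z = "Z_set leq :: ('i, 'k) mat set"
  let ?Q = "?G Mod ?Z"
  interpret N: normal ?Z ?G by (rule normal_Z_set)
  interpret Q: group ?Q by (rule N.factorgroup_is_group)
  have carrier: "carrier ?G = AU_set leq" and mult: "x \<otimes>\<^bsub>AU leq\<^esub> y = mat_mult x y"
    and one: "\<one>\<^bsub>?G\<^esub> = mat_one" for x y :: "('i, 'k) mat"
    by (simp_all add: AU_def)
  have coset: "?Z #>\<^bsub>?G\<^esub> y \<in> carrier ?Q" if "y \<in> AU_set leq" for y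
    using that by (auto simp: FactGroup_def RCOSETS_def carrier)
  have one_comm: "X \<otimes>\<^bsub>?Q\<^esub> \<one>\<^bsub>?Q\<^esub> = \<one>\<^bsub>?Q\<^esub> \<otimes>\<^bsub>?Q\<^esub> X" if "X \<in> carrier ?Q" for X
    using Q.r_one[OF that] Q.l_one[OF that] by (rule trans[OF _ sym])
  have trivial: "X = \<one>\<^bsub>?Q\<^esub>"
    if X: "X \<in> carrier ?Q"
      and op: "openin (quotient_group_topology ?G ?Z (AU_topology leq)) (centraliser ?Q X)" for X
  proof -
    obtain x where x: "x \<in> AU_set leq" "X = ?Z #>\<^bsub>?G\<^esub> x"
      using X by (auto simp: FactGroup_def RCOSETS_def carrier)
    have one_coset: "?Z #>\<^bsub>?G\<^esub> \<one>\<^bsub>?G\<^esub> = \<one>\<^bsub>?Q\<^esub>"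
      using N.subset by (simp add: FactGroup_def)
    \<comment> \<open>The preimage of the open centraliser is open and contains the identity matrix,
      so it contains a basic neighbourhood \<open>AU_nhd leq mat_one S\<close>.\<close>
    have "?Z #>\<^bsub>?G\<^esub> mat_one \<in> centraliser ?Q X"
      unfolding centraliser_def one_coset[unfolded one] using Q.one_closed one_comm[OF X] by blast
    then have "mat_one \<in> {y \<in> carrier ?G. ?Z #>\<^bsub>?G\<^esub> y \<in> centraliser ?Q X}"
      using N.one_closed by (simp add: one)
    moreover have "openin (AU_nhd_topology leq) {y \<in> carrier ?G. ?Z #>\<^bsub>?G\<^esub> y \<in> centraliser ?Q X}"
      using op unfolding openin_quotient_group_topology AU_topology_eq by blast
    ultimately obtain S where S: "finite S"
      "AU_nhd leq mat_one S \<subseteq> {y \<in> carrier ?G. ?Z #>\<^bsub>?G\<^esub> y \<in> centraliser ?Q X}"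
      unfolding openin_AU_nhd_topology by blast
    have "\<exists>c. mat_mult x y = (\<lambda>p. c * mat_mult y x p)" if "y \<in> AU_nhd leq mat_one S" for y
    proof -
      have y: "y \<in> carrier ?G" "?Z #>\<^bsub>?G\<^esub> y \<in> centraliser ?Q X"
        using S(2) that by auto
      \<comment> \<open>Commuting in the quotient means that xy and yx have the same coset, that is,
        they differ by a nonzero scalar.\<close>
      then have "?Z #>\<^bsub>?G\<^esub> (x \<otimes>\<^bsub>?G\<^esub> y) = ?Z #>\<^bsub>?G\<^esub> (y \<otimes>\<^bsub>?G\<^esub> x)"
        using x by (simp add: centraliser_def FactGroup_def N.rcos_sum carrier)
      moreover have "x \<otimes>\<^bsub>?G\<^esub> y \<in> ?Z #>\<^bsub>?G\<^esub> (x \<otimes>\<^bsub>?G\<^esub> y)"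
        using x y N.rcos_self N.subgroup_axioms by (simp add: carrier[symmetric])
      ultimately obtain z where z: "z \<in> ?Z" "mat_mult x y = mat_mult z (mat_mult y x)"
        by (auto simp: r_coset_def mult)
      then show ?thesis
        unfolding Z_set_eq by (auto simp: mat_mult_scalar_left)
    qed
    then have "x \<in> ?Z"
      by (rule scalar_if_locally_central[OF assms(3) x(1) S(1)])
    then have "?Z #>\<^bsub>?G\<^esub> x = ?Z"
      using N.rcos_const[OF N.is_group] by blast
    then show ?thesis by (simp add: x(2) FactGroup_def)
  qed
  \<comment> \<open>The identity is quasi-central: the preimage of its centraliser is the whole
    space.\<close>
  have "centraliser ?Q \<one>\<^bsub>?Q\<^esub> = carrier ?Q"
    unfolding centraliser_def using one_comm[THEN sym] by blast
  moreover have "{y \<in> carrier ?G. ?Z #>\<^bsub>?G\<^esub> y \<in> carrier ?Q} = topspace (AU_nhd_topology leq)"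
    using coset by (auto simp: carrier)
  ultimately have "openin (quotient_group_topology ?G ?Z (AU_topology leq)) (centraliser ?Q \<one>\<^bsub>?Q\<^esub>)"
    unfolding openin_quotient_group_topology AU_topology_eq by (metis openin_topspace subset_refl)
  then have "\<one>\<^bsub>?Q\<^esub> \<in> quasi_centre ?Q (quotient_group_topology ?G ?Z (AU_topology leq))"
    unfolding quasi_centre_def using Q.one_closed by blast
  moreover have "quasi_centre ?Q (quotient_group_topology ?G ?Z (AU_topology leq)) \<subseteq> {\<one>\<^bsub>?Q\<^esub>}"
    unfolding quasi_centre_def using trivial by blast
  ultimately show ?thesis by blast
qed

end
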